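(* Let $w\in c_1$ have (unique) reduced expression $w=s_1s_2\cdots s_n$ with $\{s_1,s_2,s_3\}=S$, and let $u\in(c_0)^w_3$. If $\mu(u,w)\neq0$, then $u$ satisfies: $|L(u)|=|R(u)|=2$, $s_1\in L(u)$, $s_n\in R(u)$, $s_2\notin L(u)$ and $s_{n-1}\notin R(u)$.
   Context: $W$ is the affine Weyl group of type $\widetilde A_2$: the Coxeter group on $S=\{r,s,t\}$ with $(rs)^3=(st)^3=(rt)^3=1$, with length $l$ and Bruhat order $\le$. For $u<w$, $\mu(u,w)$ is the coefficient of $q^{(l(w)-l(u)-1)/2}$ in the Kazhdan–Lusztig polynomial $P_{u,w}$. $c_1$ is the set of elements $w\neq e$ having a unique reduced expression (the two-sided cell of $\mathbf a$-value 1), and $c_0=W\setminus(\{e\}\cup c_1)$ (the two-sided cell of $\mathbf a$-value 3). For $w\in W$, $L(w)=\{\sigma\in S:\sigma w<w\}$, $R(w)=\{\sigma\in S: w\sigma<w\}$, and $(c_0)^w_3=\{u\in c_0: u<w,\ l(w)-l(u)=3\}$. *)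

theory Defs
  imports "HOL-Library.Poly_Mapping" "HOL-Computational_Algebra.Polynomial"
begin

text \<open>The group is the presented one: words in three letters modulo the congruence
  generated by \<open>aa = 1\<close> and \<open>(ab)\<^sup>3 = 1\<close> for distinct letters \<open>a\<close>, \<open>b\<close>.\<close>

datatype letter = Lr | Ls | Lt

inductive word_eq :: "letter list \<Rightarrow> letter list \<Rightarrow> bool" where
  invol: "word_eq [a, a] []"
| braid: "a \<noteq> b \<Longrightarrow> word_eq [a, b, a, b, a, b] []"
| refl: "word_eq xs xs"
| sym: "word_eq xs ys \<Longrightarrow> word_eq ys xs"
| trans: "word_eq xs ys \<Longrightarrow> word_eq ys zs \<Longrightarrow> word_eq xs zs"
| append: "word_eq xs xs' \<Longrightarrow> word_eq ys ys' \<Longrightarrow> word_eq (xs @ ys) (xs' @ ys')"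

lemma equivp_word_eq: "equivp word_eq"
  by (rule equivpI)
    (auto intro!: reflpI sympI transpI intro: word_eq.refl word_eq.sym word_eq.trans)

quotient_type weyl = "letter list" / word_eq
  by (rule equivp_word_eq)

instantiation weyl :: monoid_mult
begin

lift_definition one_weyl :: weyl is "[]" .

lift_definition times_weyl :: "weyl \<Rightarrow> weyl \<Rightarrow> weyl" is "(@)"
  by (rule word_eq.append)

instance
  by standard (transfer; simp add: word_eq.refl)+

end

lemma word_eq_rev: "word_eq xs ys \<Longrightarrow> word_eq (rev xs) (rev ys)"
proof (induction rule: word_eq.induct)
  case (invol a)
  show ?case by (simp add: word_eq.invol)
next
  case (braid a b)
  then show ?case using word_eq.braid[of b a] by auto
qed (auto intro: word_eq.intros)

lift_definition winv :: "weyl \<Rightarrow> weyl" is rev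
  by (rule word_eq_rev)

lemma word_eq_rev_append: "word_eq (rev xs @ xs) []"
proof (induction xs)
  case Nil
  show ?case by (simp add: word_eq.refl)
next
  case (Cons a xs)
  have "word_eq ([a, a] @ xs) ([] @ xs)"
    by (intro word_eq.append word_eq.invol word_eq.refl)
  then have "word_eq (rev xs @ ([a, a] @ xs)) (rev xs @ ([] @ xs))"
    using word_eq.append word_eq.refl by blast
  then show ?case using Cons.IH by (auto intro: word_eq.trans)
qed

lemma winv_left: "winv w * w = 1"
  by transfer (rule word_eq_rev_append)

lemma winv_right: "w * winv w = 1"
  by transfer (metis word_eq_rev_append rev_rev_ident)

lift_definition gen_r :: weyl is "[Lr]" .
lift_definition gen_s :: weyl is "[Ls]" .
lift_definition gen_t :: weyl is "[Lt]" .

definition simples :: "weyl set" where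
  "simples = {gen_r, gen_s, gen_t}"

definition expression :: "weyl list \<Rightarrow> weyl \<Rightarrow> bool" where
  "expression ss w \<longleftrightarrow> set ss \<subseteq> simples \<and> prod_list ss = w"

definition len :: "weyl \<Rightarrow> nat" where
  "len w = (LEAST n. \<exists>ss. expression ss w \<and> length ss = n)"

definition reduced_expression :: "weyl list \<Rightarrow> weyl \<Rightarrow> bool" where
  "reduced_expression ss w \<longleftrightarrow> expression ss w \<and> length ss = len w"

definition reflections :: "weyl set" where
  "reflections = {x * a * winv x | x a. a \<in> simples}"

definition bruhat_step :: "weyl \<Rightarrow> weyl \<Rightarrow> bool" where
  "bruhat_step u w \<longleftrightarrow> (\<exists>t\<in>reflections. w = u * t) \<and> len u < len w"

lemma bruhat_steps_len: "bruhat_step\<^sup>*\<^sup>* u w \<Longrightarrow> u = w \<or> len u < len w"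
  by (induction rule: rtranclp_induct) (auto simp: bruhat_step_def)

instantiation weyl :: order
begin

definition less_eq_weyl :: "weyl \<Rightarrow> weyl \<Rightarrow> bool" where
  "u \<le> w \<longleftrightarrow> bruhat_step\<^sup>*\<^sup>* u w"

definition less_weyl :: "weyl \<Rightarrow> weyl \<Rightarrow> bool" where
  "u < w \<longleftrightarrow> u \<le> w \<and> u \<noteq> (w :: weyl)"

instance
proof
  fix x y z :: weyl
  show antisym: "x \<le> y \<Longrightarrow> y \<le> x \<Longrightarrow> x = y"
    unfolding less_eq_weyl_def using bruhat_steps_len by (metis less_asym)
  show "x < y \<longleftrightarrow> x \<le> y \<and> \<not> y \<le> x"
    unfolding less_weyl_def less_eq_weyl_def using bruhat_steps_len
    by (metis less_asym rtranclp.rtrancl_refl)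
  show "x \<le> x"
    by (simp add: less_eq_weyl_def)
  show "x \<le> y \<Longrightarrow> y \<le> z \<Longrightarrow> x \<le> z"
    unfolding less_eq_weyl_def by (rule rtranclp_trans)
qed

end

definition left_descents :: "weyl \<Rightarrow> weyl set" where
  "left_descents w = {a \<in> simples. a * w < w}"

definition right_descents :: "weyl \<Rightarrow> weyl set" where
  "right_descents w = {a \<in> simples. w * a < w}"

text \<open>Laurent polynomials in \<open>q\<^bsup>1/2\<^esup>\<close> over the integers are finitely supported
  functions on the exponents of \<open>q\<^bsup>1/2\<^esup>\<close>, with the convolution product.
  The Hecke algebra is the free module over them with basis \<open>T\<^sub>w\<close>.\<close>

type_synonym laurent = "int \<Rightarrow>\<^sub>0 int"
type_synonym hecke = "weyl \<Rightarrow>\<^sub>0 laurent"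

definition qhalf_pow :: "int \<Rightarrow> laurent" where
  "qhalf_pow k = Poly_Mapping.single k 1"

definition hq :: laurent where
  "hq = qhalf_pow 2"

definition laurent_of_poly :: "int poly \<Rightarrow> laurent" where
  "laurent_of_poly p = (\<Sum>i\<le>degree p. Poly_Mapping.single (2 * int i) (coeff p i))"

definition laurent_bar :: "laurent \<Rightarrow> laurent" where
  "laurent_bar f = Poly_Mapping.map_key uminus f"

definition hT :: "weyl \<Rightarrow> hecke" where
  "hT w = Poly_Mapping.single w 1"

definition hscale :: "laurent \<Rightarrow> hecke \<Rightarrow> hecke" where
  "hscale c h = Poly_Mapping.map ((*) c) h"

definition mult_Ts :: "weyl \<Rightarrow> hecke \<Rightarrow> hecke" where
  "mult_Ts a h = (\<Sum>w\<in>Poly_Mapping.keys h. hscale (Poly_Mapping.lookup h w)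
     (if len w < len (a * w) then hT (a * w)
      else hscale (hq - 1) (hT w) + hscale hq (hT (a * w))))"

text \<open>\<open>T\<^sub>x = T\<^sub>a\<^sub>1 \<cdots> T\<^sub>a\<^sub>k\<close> for every reduced expression \<open>x = a\<^sub>1 \<cdots> a\<^sub>k\<close>, so the choice
  of the expression is immaterial.\<close>

definition mult_T :: "weyl \<Rightarrow> hecke \<Rightarrow> hecke" where
  "mult_T x h = foldr mult_Ts (SOME ss. reduced_expression ss x) h"

definition hecke_mult :: "hecke \<Rightarrow> hecke \<Rightarrow> hecke" where
  "hecke_mult g h = (\<Sum>x\<in>Poly_Mapping.keys g. hscale (Poly_Mapping.lookup g x) (mult_T x h))"

definition hecke_inverse :: "hecke \<Rightarrow> hecke" where
  "hecke_inverse h = (THE g. hecke_mult h g = hT 1 \<and> hecke_mult g h = hT 1)"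

definition hecke_bar :: "hecke \<Rightarrow> hecke" where
  "hecke_bar h = (\<Sum>w\<in>Poly_Mapping.keys h.
     hscale (laurent_bar (Poly_Mapping.lookup h w)) (hecke_inverse (hT (winv w))))"

text \<open>The \<open>q\<^bsup>-l(w)/2\<^esup> \<Sum>\<^bsub>y \<le> w\<^esub> P\<^bsub>y,w\<^esub> T\<^sub>y\<close> normalisation of the Kazhdan--Lusztig basis
  is used. The polynomial is 0 unless \<open>y \<le> w\<close>.\<close>

definition kl_element :: "weyl \<Rightarrow> (weyl \<Rightarrow> int poly) \<Rightarrow> hecke" where
  "kl_element w P = hscale (qhalf_pow (- int (len w)))
     (\<Sum>y | y \<le> w. hscale (laurent_of_poly (P y)) (hT y))"

definition is_kl_family :: "weyl \<Rightarrow> (weyl \<Rightarrow> int poly) \<Rightarrow> bool" where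
  "is_kl_family w P \<longleftrightarrow>
     hecke_bar (kl_element w P) = kl_element w P \<and>
     P w = 1 \<and>
     (\<forall>y. y < w \<longrightarrow> 2 * degree (P y) + 1 \<le> len w - len y) \<and>
     (\<forall>y. \<not> y \<le> w \<longrightarrow> P y = 0)"

definition kl_poly :: "weyl \<Rightarrow> weyl \<Rightarrow> int poly" where
  "kl_poly y w = (THE P. is_kl_family w P) y"

text \<open>For \<open>u < w\<close> with \<open>l(w) - l(u)\<close> even the exponent is not an integer and the coefficient is 0.\<close>

definition mu :: "weyl \<Rightarrow> weyl \<Rightarrow> int" where
  "mu u w = (if u < w \<and> odd (len w - len u)
     then coeff (kl_poly u w) ((len w - len u - 1) div 2) else 0)"

definition c1 :: "weyl set" where
  "c1 = {w. w \<noteq> 1 \<and> (\<exists>!ss. reduced_expression ss w)}"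

definition c0 :: "weyl set" where
  "c0 = UNIV - ({1} \<union> c1)"

definition c0_below :: "nat \<Rightarrow> weyl \<Rightarrow> weyl set" where
  "c0_below k w = {u \<in> c0. u < w \<and> len w - len u = k}"

end

theory Submission
  imports Defs
begin

text \<open>Write \<open>w = s\<^sub>1 \<cdots> s\<^sub>n\<close> (a cyclic word in the three letters), \<open>v = s\<^sub>1w\<close> and
  \<open>v' = s\<^sub>2v\<close>. If \<open>\<mu>(u,w) \<noteq> 0\<close>, then \<open>P\<^bsub>u,w\<^esub> = P\<^bsub>au,w\<^esub>\<close> for \<open>a \<in> L(w)\<close> forces \<open>s\<^sub>1 \<in> L(u)\<close>,
  and in length difference 3 the recursion for \<open>P\<^bsub>u,w\<^esub>\<close> collapses to
  \<open>\<mu>(u,w) = \<mu>(s\<^sub>1u,v) + [u \<le> v] - #{z. u \<le> z < v, l(z) = l(v) - 1, s\<^sub>1z < z}\<close>.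
  If \<open>L(u) = {s\<^sub>1}\<close>, then \<open>u \<le> v\<close> would by lifting give \<open>u = s\<^sub>4 \<cdots> s\<^sub>n\<close>, which is not in \<open>c\<^sub>0\<close>,
  and \<open>\<mu>(s\<^sub>1u,v)\<close> vanishes by induction. If \<open>s\<^sub>1, s\<^sub>2 \<in> L(u)\<close>, the only possible \<open>z\<close> is
  \<open>s\<^sub>2s\<^sub>4 \<cdots> s\<^sub>n\<close>, which occurs exactly when \<open>u \<le> v\<close>, and \<open>\<mu>(s\<^sub>1u,v) = \<mu>(s\<^sub>2s\<^sub>1u,v') = 0\<close>,
  again by induction. The key fact about the group is that \<open>a, b \<in> L(g)\<close> implies
  \<open>c \<notin> L(ag)\<close> for the third generator \<open>c\<close>. The claims about \<open>R(u)\<close> follow from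
  \<open>\<mu>(u,w) = \<mu>(u\<^sup>-\<^sup>1,w\<^sup>-\<^sup>1)\<close>.\<close>

subsection \<open>The generators\<close>

lift_definition gen :: "letter \<Rightarrow> weyl" is "\<lambda>a. [a]" .

lemma simples_eq_range_gen: "simples = range gen"
proof -
  have "gen_r = gen Lr" "gen_s = gen Ls" "gen_t = gen Lt"
    by (transfer, rule word_eq.refl)+
  moreover have "range gen = gen ` {Lr, Ls, Lt}"
    by (rule arg_cong[where f = "image gen"]) (use letter.exhaust in auto)
  ultimately show ?thesis by (simp add: simples_def)
qed

lemma abs_weyl_Nil: "abs_weyl [] = 1"
  by (simp add: one_weyl.abs_eq)

lemma abs_weyl_append: "abs_weyl (xs @ ys) = abs_weyl xs * abs_weyl ys"
  by (simp add: times_weyl.abs_eq)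

lemma abs_weyl_Cons: "abs_weyl (a # xs) = gen a * abs_weyl xs"
  by (simp add: times_weyl.abs_eq gen.abs_eq)

lemma simple_sq [simp]: "a \<in> simples \<Longrightarrow> a * a = 1"
  unfolding simples_eq_range_gen
  using word_eq.invol by (auto simp: gen.abs_eq times_weyl.abs_eq one_weyl.abs_eq weyl.abs_eq_iff)

lemma simple_sq_left [simp]: "a \<in> simples \<Longrightarrow> a * (a * x) = x"
  by (metis mult.assoc mult_1 simple_sq)

lemma simple_cancel [simp]: "a \<in> simples \<Longrightarrow> a * x = a * y \<longleftrightarrow> x = y"
  by (metis simple_sq_left)

lemma simple_conj_eq_iff: "a \<in> simples \<Longrightarrow> a * t * a = b \<longleftrightarrow> t = a * b * a"
  by (auto simp: mult.assoc)

lemma simple_braid: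
  assumes "a \<in> simples" "b \<in> simples" "a \<noteq> b"
  shows "a * (b * a) = b * (a * b)"
proof -
  obtain i j where ij: "a = gen i" "b = gen j" "i \<noteq> j"
    using assms unfolding simples_eq_range_gen by auto
  have "a * (b * (a * (b * (a * b)))) = 1"
    unfolding ij(1,2) using ij(3) by transfer (simp add: word_eq.braid)
  then have "b * (a * b) = b * (a * b) * (a * (b * (a * (b * (a * b)))))" by simp
  also have "... = a * (b * (a * (b * (a * b)))) * (a * (b * a))"
    using assms(1,2) \<open>a * (b * (a * (b * (a * b)))) = 1\<close>
    by (metis (no_types, lifting) mult.assoc mult.right_neutral simple_sq_left)
  also have "... = a * (b * a)"
    using \<open>a * (b * (a * (b * (a * b)))) = 1\<close> by simp
  finally show ?thesis ..
qed

lemma simple_braid_left: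
  assumes "a \<in> simples" "b \<in> simples" "a \<noteq> b"
  shows "a * (b * (a * x)) = b * (a * (b * x))"
  using arg_cong[OF simple_braid[OF assms], of "\<lambda>y. y * x"] by (simp add: mult.assoc)

lemma simple_ababa:
  assumes "a \<in> simples" "b \<in> simples" "a \<noteq> b"
  shows "a * (b * (a * (b * a))) = b"
  using simple_braid_left[OF assms, of "b * a"] assms by simp

text \<open>The homomorphism from the group onto the symmetric group of the three letters: a
  generator acts as the transposition fixing its own letter. It serves to show that the three
  generators are distinct in the quotient.\<close>

fun swap_others :: "letter \<Rightarrow> letter \<Rightarrow> letter" where
  "swap_others Lr Lr = Lr" | "swap_others Lr Ls = Lt" | "swap_others Lr Lt = Ls"
| "swap_others Ls Lr = Lt" | "swap_others Ls Ls = Ls" | "swap_others Ls Lt = Lr"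
| "swap_others Lt Lr = Ls" | "swap_others Lt Ls = Lr" | "swap_others Lt Lt = Lt"

lemma foldr_swap_others_cong: "word_eq xs ys \<Longrightarrow> foldr swap_others xs = foldr swap_others ys"
proof (induction rule: word_eq.induct)
  case (invol a)
  have "swap_others a (swap_others a x) = x" for x by (cases a; cases x) auto
  then show ?case by auto
next
  case (braid a b)
  have "foldr swap_others [a, b, a, b, a, b] x = x" for x
    using braid by (cases a; cases b; cases x) auto
  then show ?case by auto
qed auto

lemma inj_gen: "inj gen"
proof (rule injI)
  fix a b assume "gen a = gen b"
  then have "word_eq [a] [b]" by (simp add: gen.abs_eq weyl.abs_eq_iff)
  then have "swap_others a = swap_others b" using foldr_swap_others_cong by fastforce
  then have "\<forall>x. swap_others a x = swap_others b x" by simp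
  then show "a = b" by (cases a; cases b) (metis letter.distinct swap_others.simps)+
qed

lemma card_simples: "card simples = 3"
proof -
  have "(UNIV :: letter set) = {Lr, Ls, Lt}" using letter.exhaust by auto
  then have "card (UNIV :: letter set) = card {Lr, Ls, Lt}" by (rule arg_cong)
  then have "card (UNIV :: letter set) = 3" by simp
  then show ?thesis by (simp add: simples_eq_range_gen card_image inj_gen)
qed

text \<open>Lets the single hypothesis \<open>simples = {a, b, c}\<close> stand for a labelling of
  the generators in any order.\<close>

lemma simples_distinct:
  assumes "simples = {a, b, c}" shows "a \<noteq> b \<and> b \<noteq> c \<and> a \<noteq> c"
proof -
  have "card {a, b, c} = 3" using card_simples by (simp only: assms)
  then show ?thesis by (auto simp: card_insert_if split: if_splits)
qed

lemma winv_winv [simp]: "winv (winv x) = x"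
  by transfer (simp add: word_eq.refl)

lemma winv_mult: "winv (x * y) = winv y * winv x"
  by transfer (simp add: word_eq.refl)

lemma winv_one [simp]: "winv 1 = 1"
  by transfer (simp add: word_eq.refl)

lemma winv_simple [simp]: "a \<in> simples \<Longrightarrow> winv a = a"
  unfolding simples_eq_range_gen by (auto, transfer, simp add: word_eq.refl)

lemma winv_mult_left [simp]: "winv x * (x * y) = y"
  by (metis mult.assoc mult_1 winv_left)

lemma mult_winv_left [simp]: "x * (winv x * y) = y"
  by (metis mult.assoc mult_1 winv_right)

declare winv_left [simp] winv_right [simp]

lemma mult_right_cancel_weyl [simp]: "(y::weyl) * x = z * x \<longleftrightarrow> y = z"
  by (metis mult.assoc mult.right_neutral winv_right)

lemma winv_eq_iff: "winv x = winv y \<longleftrightarrow> x = y"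
  by (metis winv_winv)

lemma bij_winv: "bij winv"
  by (metis bij_betw_byWitness[of UNIV winv winv UNIV] winv_winv subset_UNIV)

subsection \<open>Length and exchange\<close>

lemma expression_exists: "\<exists>ss. expression ss w"
proof -
  obtain xs where "w = abs_weyl xs" by (metis Quotient_abs_rep Quotient_weyl)
  moreover have "prod_list (map gen xs) = abs_weyl xs"
    by (induction xs) (simp_all add: abs_weyl_Nil abs_weyl_Cons)
  ultimately have "expression (map gen xs) w"
    by (auto simp: expression_def simples_eq_range_gen)
  then show ?thesis ..
qed

lemma len_le: "expression ss w \<Longrightarrow> len w \<le> length ss"
  unfolding len_def by (rule Least_le) auto

lemma reduced_expression_exists: "\<exists>ss. reduced_expression ss w"
  unfolding reduced_expression_def len_def using expression_exists
  by (smt (verit, best) LeastI_ex)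

lemma len_one [simp]: "len 1 = 0"
  using len_le[of "[]" 1] by (simp add: expression_def)

lemma len_eq_0_iff [simp]: "len w = 0 \<longleftrightarrow> w = 1"
  using reduced_expression_exists[of w]
  by (auto simp: reduced_expression_def expression_def)

lemma expression_rev: "expression ss w \<Longrightarrow> expression (rev ss) (winv w)"
proof (induction ss arbitrary: w)
  case (Cons a ss)
  then have "expression ss (a * w)" by (auto simp: expression_def)
  from Cons.IH[OF this] Cons.prems show ?case
    by (auto simp: expression_def winv_mult mult.assoc)
qed (auto simp: expression_def)

lemma len_winv [simp]: "len (winv w) = len w"
proof -
  have "len (winv x) \<le> len x" for x
    using reduced_expression_exists[of x] expression_rev len_le
    by (metis length_rev reduced_expression_def)
  from this[of w] this[of "winv w"] show ?thesis by simp
qed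

lemma reduced_expression_rev: "reduced_expression ss w \<Longrightarrow> reduced_expression (rev ss) (winv w)"
  by (simp add: reduced_expression_def expression_rev)

lemma len_simple_mult_le: "a \<in> simples \<Longrightarrow> len (a * w) \<le> Suc (len w)"
  using reduced_expression_exists[of w] len_le[of "a # _" "a * w"]
  by (fastforce simp: reduced_expression_def expression_def)

text \<open>The parity of the number of occurrences of the reflection \<open>t\<close> among the
  \<open>a\<^sub>1 \<cdots> a\<^sub>i\<^sub>-\<^sub>1 a\<^sub>i a\<^sub>i\<^sub>-\<^sub>1 \<cdots> a\<^sub>1\<close>. It depends only on the element represented by the word, and is odd
  exactly when \<open>t\<close> shortens this element.\<close>

fun inversion_parity :: "letter list \<Rightarrow> weyl \<Rightarrow> bool" where
  "inversion_parity [] t = False"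
| "inversion_parity (a # xs) t = ((t = gen a) \<noteq> inversion_parity xs (gen a * t * gen a))"

lemma gen_simple [simp]: "gen a \<in> simples"
  by (simp add: simples_eq_range_gen)

lemma inversion_parity_append:
  "inversion_parity (xs @ ys) t =
    (inversion_parity xs t \<noteq> inversion_parity ys (winv (abs_weyl xs) * t * abs_weyl xs))"
  by (induction xs arbitrary: t) (auto simp: abs_weyl_Nil abs_weyl_Cons winv_mult mult.assoc)

text \<open>For the braid relation, the six tests along \<open>ababab\<close> ask whether
  \<open>t\<close> is \<open>x\<close>, \<open>xyx\<close>, \<open>y\<close>, \<open>x\<close>,
  \<open>xyx\<close>, \<open>y\<close> in turn. Each candidate occurs twice, so the parities
  cancel.\<close>

lemma inversion_parity_cong:
  "word_eq xs ys \<Longrightarrow> inversion_parity xs t = inversion_parity ys t"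
proof (induction arbitrary: t rule: word_eq.induct)
  case (invol a)
  show ?case by (simp add: simple_conj_eq_iff)
next
  case (braid a b)
  define x y where "x = gen a" and "y = gen b"
  have xy: "x \<in> simples" "y \<in> simples" "x \<noteq> y"
    using braid inj_gen by (auto simp: x_def y_def inj_eq)
  have br: "x * (y * x) = y * (x * y)" "x * (y * (x * (y * x))) = y"
    "y * (x * (y * (x * y))) = x"
    using simple_braid[OF xy] simple_ababa xy by simp_all
  have 1: "x * t * x = y \<longleftrightarrow> t = x * (y * x)"
    using simple_conj_eq_iff[OF xy(1)] by (simp add: mult.assoc)
  have 2: "y * (x * t * x) * y = x \<longleftrightarrow> t = y"
    unfolding simple_conj_eq_iff[OF xy(1)] simple_conj_eq_iff[OF xy(2)]
    using xy br by (simp add: mult.assoc)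
  have 3: "x * (y * (x * t * x) * y) * x = y \<longleftrightarrow> t = x"
    unfolding simple_conj_eq_iff[OF xy(1)] simple_conj_eq_iff[OF xy(2)]
    using xy br by (simp add: mult.assoc)
  have 4: "y * (x * (y * (x * t * x) * y) * x) * y = x \<longleftrightarrow> t = x * (y * x)"
    unfolding simple_conj_eq_iff[OF xy(1)] simple_conj_eq_iff[OF xy(2)]
    using xy br by (simp add: mult.assoc)
  have 5: "x * (y * (x * (y * (x * t * x) * y) * x) * y) * x = y \<longleftrightarrow> t = y"
    unfolding simple_conj_eq_iff[OF xy(1)] simple_conj_eq_iff[OF xy(2)]
    using xy br by (simp add: mult.assoc)
  show ?case
    unfolding inversion_parity.simps x_def[symmetric] y_def[symmetric] 1 2 3 4 5 by blast
next
  case (append xs xs' ys ys')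
  then have "abs_weyl xs = abs_weyl xs'" by (simp add: weyl.abs_eq_iff)
  with append show ?case by (simp add: inversion_parity_append)
qed auto

definition inverts :: "weyl \<Rightarrow> weyl \<Rightarrow> bool" where
  "inverts w t = inversion_parity (rep_weyl w) t"

lemma inverts_abs_weyl: "inverts (abs_weyl xs) t = inversion_parity xs t"
  unfolding inverts_def
  by (rule inversion_parity_cong) (metis Quotient_rep_abs Quotient_weyl equivp_reflp equivp_word_eq)

lemma abs_weyl_cases: obtains xs where "w = abs_weyl xs"
  by (metis Quotient_abs_rep Quotient_weyl)

lemma inverts_one [simp]: "\<not> inverts 1 t"
  using inverts_abs_weyl[of "[]"] by (simp add: abs_weyl_Nil)

text \<open>The cocycle identity for left inversion sets: that of a product is the symmetric
  difference of that of \<open>x\<close> and the conjugate by \<open>x\<close> of that of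
  \<open>y\<close>.\<close>

lemma inverts_mult: "inverts (x * y) t = (inverts x t \<noteq> inverts y (winv x * t * x))"
  by (rule abs_weyl_cases[of x], rule abs_weyl_cases[of y])
    (simp add: abs_weyl_append[symmetric] inverts_abs_weyl inversion_parity_append)

lemma inverts_simple: "a \<in> simples \<Longrightarrow> inverts a t \<longleftrightarrow> t = a"
  unfolding simples_eq_range_gen using inverts_abs_weyl[of "[_]"] by (auto simp: gen.abs_eq)

lemma inverts_simple_mult:
  "a \<in> simples \<Longrightarrow> inverts (a * w) t = ((t = a) \<noteq> inverts w (a * t * a))"
  by (simp add: inverts_mult inverts_simple)

lemma simple_reflection: "a \<in> simples \<Longrightarrow> a \<in> reflections"
  unfolding reflections_def by (metis (mono_tags, lifting) mem_Collect_eq mult.right_neutral mult_1 winv_one)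

lemma reflection_sq: "t \<in> reflections \<Longrightarrow> t * t = 1"
  by (auto simp: reflections_def mult.assoc)

lemma reflection_sq_left: "t \<in> reflections \<Longrightarrow> t * (t * x) = x"
  by (metis reflection_sq mult.assoc mult_1)

lemma winv_reflection: "t \<in> reflections \<Longrightarrow> winv t = t"
  by (auto simp: reflections_def mult.assoc winv_mult)

lemma conj_reflection: "t \<in> reflections \<Longrightarrow> x * t * winv x \<in> reflections"
proof -
  assume "t \<in> reflections"
  then obtain y a where "t = y * a * winv y" "a \<in> simples" by (auto simp: reflections_def)
  then have "x * t * winv x = (x * y) * a * winv (x * y)" "a \<in> simples"
    by (simp_all add: winv_mult mult.assoc)
  then show ?thesis unfolding reflections_def by blast
qed

text \<open>Expand both \<open>1 = x * winv x\<close> and \<open>t = x * a * winv x\<close> by the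
  cocycle identity. The two parities at \<open>t\<close> differ exactly by the contribution of
  \<open>a\<close> at itself, and the first is even.\<close>

lemma reflection_inverts_self:
  assumes "t \<in> reflections" shows "inverts t t"
proof -
  obtain x a where t: "t = x * (a * winv x)" and a: "a \<in> simples"
    using assms by (auto simp: reflections_def mult.assoc)
  have "inverts (x * winv x) t = (inverts x t \<noteq> inverts (winv x) a)"
    by (subst inverts_mult) (simp add: t mult.assoc)
  moreover have "inverts (x * (a * winv x)) t = (inverts x t \<noteq> (True \<noteq> inverts (winv x) a))"
    using a by (subst inverts_mult, subst inverts_simple_mult) (simp_all add: t mult.assoc)
  ultimately show ?thesis by (simp add: t)
qed

text \<open>The strong exchange condition. If \<open>t\<close> is not the first letter, conjugating
  it by that letter passes the inversion on to the remaining word.\<close>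

lemma exchange:
  assumes "expression ss w" "inverts w t"
  shows "\<exists>xs a ys. ss = xs @ a # ys \<and> expression (xs @ ys) (t * w)"
  using assms
proof (induction ss arbitrary: w t)
  case Nil
  then show ?case by (simp add: expression_def)
next
  case (Cons a ss)
  define v where "v = prod_list ss"
  have a: "a \<in> simples" and w: "w = a * v" and v: "expression ss v"
    using Cons.prems by (auto simp: expression_def v_def)
  show ?case
  proof (cases "t = a")
    case True
    then have "expression ([] @ ss) (t * w)" using a v w by simp
    then show ?thesis by fastforce
  next
    case False
    then have "inverts v (a * t * a)" using Cons.prems(2) a w by (simp add: inverts_simple_mult)
    from Cons.IH[OF v this] obtain xs b ys
      where "ss = xs @ b # ys" "expression (xs @ ys) (a * t * a * v)" by blast
    moreover from this(2) have "expression ((a # xs) @ ys) (t * w)"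
      using a w by (simp add: expression_def mult.assoc)
    ultimately show ?thesis by (metis append_Cons)
  qed
qed

lemma inverts_imp_len_less:
  assumes "inverts w t" shows "len (t * w) < len w"
proof -
  obtain ss where ss: "expression ss w" "length ss = len w"
    using reduced_expression_exists[of w] by (auto simp: reduced_expression_def)
  from exchange[OF ss(1) assms] obtain xs a ys
    where "ss = xs @ a # ys" "expression (xs @ ys) (t * w)" by blast
  then show ?thesis using len_le[of "xs @ ys"] ss(2) by fastforce
qed

text \<open>Since \<open>t\<close> inverts itself, exactly one of \<open>w\<close> and
  \<open>t * w\<close> inverts \<open>t\<close>, so the previous bound applies to
  \<open>t * w\<close>.\<close>

lemma not_inverts_imp_len_greater:
  assumes "t \<in> reflections" "\<not> inverts w t" shows "len w < len (t * w)"
proof -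
  have "inverts (t * w) t"
    using assms by (simp add: inverts_mult reflection_inverts_self winv_reflection mult.assoc reflection_sq)
  from inverts_imp_len_less[OF this] show ?thesis using assms by (simp add: reflection_sq_left)
qed

lemma inverts_iff: "t \<in> reflections \<Longrightarrow> inverts w t \<longleftrightarrow> len (t * w) < len w"
  using inverts_imp_len_less not_inverts_imp_len_greater by (metis less_asym)

lemma len_simple_mult_cases:
  assumes "a \<in> simples"
  obtains "len (a * w) = Suc (len w)" | "len w = Suc (len (a * w))"
proof -
  have "len (a * w) \<noteq> len w"
    using not_inverts_imp_len_greater[OF simple_reflection[OF assms], of w]
      inverts_imp_len_less[of w a] by fastforce
  then show ?thesis
    using len_simple_mult_le[OF assms, of w] len_simple_mult_le[OF assms, of "a * w"] assms that
    by (metis antisym_conv2 less_Suc_eq_le not_less_eq simple_sq_left)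
qed

section \<open>Left descents, expressed through length alone, and pairs of descents\<close>

definition down :: "weyl \<Rightarrow> weyl \<Rightarrow> bool" where
  "down a w \<longleftrightarrow> len (a * w) < len w"

lemma down_iff_inverts: "a \<in> simples \<Longrightarrow> down a w \<longleftrightarrow> inverts w a"
  by (simp add: down_def inverts_iff simple_reflection)

lemma down_simple_mult [simp]: "a \<in> simples \<Longrightarrow> down a (a * w) \<longleftrightarrow> \<not> down a w"
  unfolding down_def by (rule len_simple_mult_cases[of a w]) auto

lemma len_down: "a \<in> simples \<Longrightarrow> down a w \<Longrightarrow> len w = Suc (len (a * w))"
  unfolding down_def by (rule len_simple_mult_cases[of a w]) auto

lemma len_up: "a \<in> simples \<Longrightarrow> \<not> down a w \<Longrightarrow> len (a * w) = Suc (len w)"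
  unfolding down_def by (rule len_simple_mult_cases[of a w]) auto

lemma not_down_one [simp]: "\<not> down a 1"
  by (simp add: down_def)

text \<open>Moving \<open>a\<close> inwards through \<open>b\<close> and \<open>a\<close> conjugates
  it to \<open>ababa = b\<close>, so the claim becomes that \<open>b\<close> is an inversion of
  \<open>g\<close>. With the next lemma this says that \<open>g\<close> has a reduced expression
  beginning with \<open>aba\<close>.\<close>

lemma down_dihedral2:
  assumes "a \<in> simples" "b \<in> simples" "a \<noteq> b" "down a g" "down b g"
  shows "down a (b * (a * g))"
proof -
  have neq: "b * (a * b) \<noteq> a"
    using assms by (metis simple_braid simple_cancel simple_sq mult.right_neutral mult_right_cancel_weyl)
  have "a * (b * (a * (b * a))) = b"
    using assms by (intro simple_ababa)
  then show ?thesis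
    using assms neq by (simp add: inverts_simple_mult down_iff_inverts mult.assoc)
qed

text \<open>Otherwise the reflection \<open>aba\<close> would not be an inversion of
  \<open>g\<close>, and multiplying by it would lengthen \<open>g\<close>. But \<open>abag\<close>
  is shorter than \<open>bag\<close>, which is no longer than \<open>g\<close>.\<close>

lemma down_dihedral:
  assumes "a \<in> simples" "b \<in> simples" "a \<noteq> b" "down a g" "down b g"
  shows "down b (a * g)"
proof (rule ccontr)
  assume "\<not> down b (a * g)"
  have r: "a * b * a \<in> reflections"
    using conj_reflection[OF simple_reflection[OF assms(2)], of a] assms(1) by simp
  have "\<not> inverts g (a * b * a)"
    using \<open>\<not> down b (a * g)\<close> assms by (simp add: down_iff_inverts inverts_simple_mult)
  then have "len g < len (a * (b * (a * g)))"
    using not_inverts_imp_len_greater[OF r] by (simp add: mult.assoc)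
  moreover have "len (a * (b * (a * g))) < len (b * (a * g))"
    using down_dihedral2[OF assms] by (simp add: down_def)
  moreover have "len (b * (a * g)) \<le> len g"
    using len_simple_mult_le[of b "a * g"] len_down[of a g] assms by simp
  ultimately show False by simp
qed

text \<open>Infinite descent: if \<open>c\<close> were a descent of \<open>ag\<close>, then the
  shorter element \<open>h = bag\<close> would have descents \<open>c\<close> and \<open>a\<close>,
  and \<open>b\<close> would be a descent of \<open>ch\<close>. This is the same forbidden
  configuration with rotated letters.\<close>

lemma not_down_third:
  assumes "simples = {a, b, c}" "down a g" "down b g"
  shows "\<not> down c (a * g)"
  using assms
proof (induction "len g" arbitrary: a b c g rule: less_induct)
  case less
  have s: "a \<in> simples" "b \<in> simples" "c \<in> simples" using less.prems(1) by auto
  have ne: "a \<noteq> b" "b \<noteq> c" "a \<noteq> c"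
    using simples_distinct[OF less.prems(1)] by auto
  show ?case
  proof
    assume c: "down c (a * g)"
    have b: "down b (a * g)" using down_dihedral s ne less.prems by blast
    define h where "h = b * (a * g)"
    have ah: "down a h" using down_dihedral2 s ne less.prems by (simp add: h_def)
    have ch: "down c h" using down_dihedral[of b c "a * g"] s ne b c by (simp add: h_def)
    have "len h < len g"
      using len_down[of a g] len_down[of b "a * g"] s less.prems b by (simp add: h_def)
    from less.hyps[OF this, of c a b] have "\<not> down b (c * h)"
      using less.prems(1) ne ah ch by auto
    moreover have "down b (c * h)"
      using down_dihedral2[of b c "a * g"] s ne b c by (simp add: h_def)
    ultimately show False by simp
  qed
qed

subsection \<open>The Bruhat order\<close>

text \<open>By the cocycle identity, multiplying by \<open>b\<close> on the right affects the
  inversion \<open>a\<close> only if \<open>winv w * a * w = b\<close>. This is used to commute left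
  and right multiplication in the Hecke algebra.\<close>

lemma down_right_mult:
  assumes "a \<in> simples" "b \<in> simples" "a * w \<noteq> w * b"
  shows "down a (w * b) \<longleftrightarrow> down a w"
proof -
  have "winv w * a * w \<noteq> b"
    using assms(3) by (metis mult.assoc mult_winv_left)
  then show ?thesis
    using assms by (simp add: down_iff_inverts inverts_mult inverts_simple)
qed

text \<open>A reflection moves across \<open>u\<close> by conjugation; the definition multiplies on
  the right, whereas the descents used below are on the left.\<close>

lemma bruhat_step_left_iff:
  "bruhat_step u w \<longleftrightarrow> (\<exists>t\<in>reflections. w = t * u) \<and> len u < len w"
proof -
  have "\<exists>t'\<in>reflections. u * t = t' * u" if "t \<in> reflections" for t
    using conj_reflection[OF that, of u] by (intro bexI[of _ "u * t * winv u"]) (simp_all add: mult.assoc)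
  moreover have "\<exists>t'\<in>reflections. t * u = u * t'" if "t \<in> reflections" for t
    using conj_reflection[OF that, of "winv u"]
    by (intro bexI[of _ "winv u * t * u"]) (simp_all add: mult.assoc)
  ultimately show ?thesis unfolding bruhat_step_def by metis
qed

lemma bruhat_step_le: "bruhat_step u w \<Longrightarrow> u \<le> w"
  by (simp add: less_eq_weyl_def)

lemma bruhat_step_winv: "bruhat_step u w \<Longrightarrow> bruhat_step (winv u) (winv w)"
  unfolding bruhat_step_left_iff[of "winv u"]
  by (auto simp: bruhat_step_def winv_mult winv_reflection)

lemma le_winv: "u \<le> w \<Longrightarrow> winv u \<le> winv w"
  unfolding less_eq_weyl_def
proof (induction rule: rtranclp_induct)
  case (step y z)
  then show ?case using bruhat_step_winv by (metis rtranclp.rtrancl_into_rtrancl)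
qed simp

lemma winv_le_winv_iff [simp]: "winv u \<le> winv w \<longleftrightarrow> u \<le> w"
  using le_winv by (metis winv_winv)

lemma winv_less_winv_iff [simp]: "winv u < winv w \<longleftrightarrow> u < w"
  by (simp add: less_weyl_def winv_eq_iff)

lemma less_imp_len_less: "(u::weyl) < w \<Longrightarrow> len u < len w"
  using bruhat_steps_len by (auto simp: less_weyl_def less_eq_weyl_def)

lemma le_imp_len_le: "(u::weyl) \<le> w \<Longrightarrow> len u \<le> len w"
  using less_imp_len_less by (metis le_less less_weyl_def)

lemma le_len_eq: "(u::weyl) \<le> w \<Longrightarrow> len w \<le> len u \<Longrightarrow> u = w"
  using less_imp_len_less by (metis less_weyl_def not_le)

lemma simple_mult_le: "a \<in> simples \<Longrightarrow> down a w \<Longrightarrow> a * w \<le> w"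
  by (rule bruhat_step_le) (auto simp: bruhat_step_left_iff down_def intro!: bexI[of _ a] simple_reflection)

lemma le_simple_mult: "a \<in> simples \<Longrightarrow> \<not> down a w \<Longrightarrow> w \<le> a * w"
  using simple_mult_le[of a "a * w"] by simp

lemma left_descents_iff: "a \<in> left_descents w \<longleftrightarrow> a \<in> simples \<and> down a w"
  using simple_mult_le[of a w] less_imp_len_less[of "a * w" w]
  by (auto simp: left_descents_def less_weyl_def down_def)

lemma right_descents_iff: "a \<in> right_descents w \<longleftrightarrow> a \<in> left_descents (winv w)"
proof -
  have "w * a < w \<longleftrightarrow> a * winv w < winv w" if "a \<in> simples"
    using that winv_less_winv_iff[of "w * a" w] by (simp add: winv_mult)
  then show ?thesis by (auto simp: left_descents_def right_descents_def)
qed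

text \<open>As \<open>t\<close> does not invert \<open>z\<close> and the conjugate
  \<open>ata\<close> differs from \<open>a\<close>, the reflection \<open>ata\<close> does not
  invert \<open>az\<close>, hence lengthens it.\<close>

lemma bruhat_step_simple_mult:
  assumes "a \<in> simples" "bruhat_step z y" "y \<noteq> a * z"
  shows "bruhat_step (a * z) (a * y)"
proof -
  obtain t where t: "t \<in> reflections" "y = t * z" "len z < len y"
    using assms(2) by (auto simp: bruhat_step_left_iff)
  have r: "a * t * a \<in> reflections" using conj_reflection[OF t(1), of a] assms(1) by simp
  have "\<not> inverts z t" using inverts_imp_len_less[of z t] t by auto
  moreover have "a * t * a \<noteq> a" using assms(1,3) t(2) by (simp add: simple_conj_eq_iff)
  ultimately have "\<not> inverts (a * z) (a * t * a)"
    using assms(1) by (simp add: inverts_simple_mult mult.assoc)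
  from not_inverts_imp_len_greater[OF r this] show ?thesis
    unfolding bruhat_step_left_iff using r t(2) assms(1) by (auto simp: mult.assoc intro!: bexI[of _ "a * (t * a)"])
qed

text \<open>The lifting property, by induction along a chain of Bruhat steps from \<open>x\<close>.
  Each step either is multiplication by \<open>a\<close> itself or survives multiplication by
  \<open>a\<close> on both ends.\<close>

lemma lifting:
  assumes "a \<in> simples" "x \<le> y" "down a y" "\<not> down a x"
  shows "x \<le> a * y"
  using assms(2,3) unfolding less_eq_weyl_def[of x y]
proof (induction rule: rtranclp_induct)
  case base
  then show ?case using assms(4) by simp
next
  case (step z y)
  then have xz: "x \<le> z" by (simp add: less_eq_weyl_def)
  show ?case
  proof (cases "y = a * z")
    case True
    then show ?thesis using xz assms(1) by simp
  next
    case False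
    then have "a * z \<le> a * y" using bruhat_step_simple_mult[OF assms(1) step(2)] bruhat_step_le by blast
    moreover have "x \<le> a * z"
      using step.IH xz le_simple_mult[OF assms(1), of z] by (metis order.trans)
    ultimately show ?thesis by (metis order.trans)
  qed
qed

text \<open>Common source of the two monotonicity lemmas below: which alternative can be absorbed
  depends on whether \<open>a\<close> is a descent of \<open>y\<close>.\<close>

lemma simple_mult_le_cases:
  assumes "a \<in> simples" "x \<le> y"
  shows "a * x \<le> y \<or> a * x \<le> a * y"
  using assms(2) unfolding less_eq_weyl_def[of x y]
proof (induction rule: rtranclp_induct)
  case (step z y)
  then have "z \<le> y" "y = a * z \<or> a * z \<le> a * y"
    using bruhat_step_simple_mult[OF assms(1) step(2)] bruhat_step_le by blast+
  then show ?case using step.IH by (metis order.trans)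
qed simp

lemma lifting_down:
  assumes "a \<in> simples" "x \<le> y" "down a y" "down a x"
  shows "a * x \<le> a * y"
  using lifting[of a "a * x" y] simple_mult_le[of a x] assms by (metis down_simple_mult order.trans)

lemma simple_mult_mono:
  assumes "a \<in> simples" "x \<le> y" "\<not> down a y"
  shows "a * x \<le> a * y"
  using simple_mult_le_cases[OF assms(1,2)] le_simple_mult[OF assms(1,3)] by (metis order.trans)

lemma simple_mult_le_down:
  assumes "a \<in> simples" "x \<le> y" "down a y"
  shows "a * x \<le> y"
  using simple_mult_le_cases[OF assms(1,2)] simple_mult_le[OF assms(1,3)] by (metis order.trans)

lemma finite_len_le: "finite {w. len w \<le> n}"
proof -
  have "{w. len w \<le> n} \<subseteq> prod_list ` {ss. set ss \<subseteq> simples \<and> length ss \<le> n}"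
  proof
    fix w assume "w \<in> {w. len w \<le> n}"
    moreover obtain ss where "reduced_expression ss w" using reduced_expression_exists by blast
    ultimately show "w \<in> prod_list ` {ss. set ss \<subseteq> simples \<and> length ss \<le> n}"
      by (intro image_eqI[of _ _ ss]) (auto simp: reduced_expression_def expression_def)
  qed
  moreover have "finite simples" by (simp add: simples_def)
  ultimately show ?thesis
    using finite_subset[OF _ finite_imageI[OF finite_lists_length_le]] by blast
qed

lemma finite_le: "finite {y. y \<le> (w::weyl)}"
  by (rule finite_subset[OF _ finite_len_le[of "len w"]]) (auto intro: le_imp_len_le)

lemma reduced_expression_Cons:
  "reduced_expression (a # ss) w \<longleftrightarrow> a \<in> simples \<and> down a w \<and> reduced_expression ss (a * w)"
proof
  assume *: "reduced_expression (a # ss) w"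
  then have a: "a \<in> simples" and e: "expression ss (a * w)" and l: "Suc (length ss) = len w"
    by (auto simp: reduced_expression_def expression_def)
  then have "len (a * w) \<le> length ss" using len_le by blast
  with a l have "down a w" "len w = Suc (len (a * w))"
    using len_down[OF a, of w] by (auto simp: down_def)
  with a e l show "a \<in> simples \<and> down a w \<and> reduced_expression ss (a * w)"
    by (simp add: reduced_expression_def)
next
  assume "a \<in> simples \<and> down a w \<and> reduced_expression ss (a * w)"
  then show "reduced_expression (a # ss) w"
    using len_down[of a w] by (auto simp: reduced_expression_def expression_def)
qed

subsection \<open>The Hecke algebra\<close>

lemma lookup_hscale [simp]: "Poly_Mapping.lookup (hscale c h) x = c * Poly_Mapping.lookup h x"
  by (simp add: hscale_def map.rep_eq when_def)

lemma lookup_hT: "Poly_Mapping.lookup (hT w) x = (if x = w then 1 else 0)"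
  by (auto simp: hT_def lookup_single when_def)

lemma hscale_add: "hscale c (g + h) = hscale c g + hscale c h"
  and hscale_add_left: "hscale (c + d) h = hscale c h + hscale d h"
  and hscale_diff: "hscale c (g - h) = hscale c g - hscale c h"
  and hscale_diff_left: "hscale (c - d) h = hscale c h - hscale d h"
  and hscale_hscale: "hscale c (hscale d h) = hscale (c * d) h"
  and hscale_one: "hscale 1 h = h"
  and hscale_zero: "hscale 0 h = 0"
  and hscale_zero_right: "hscale c 0 = 0"
  by (rule poly_mapping_eqI; simp add: lookup_add lookup_minus algebra_simps)+

lemma hscale_sum: "hscale c (\<Sum>i\<in>I. f i) = (\<Sum>i\<in>I. hscale c (f i))"
  by (induction I rule: infinite_finite_induct) (auto simp: hscale_add hscale_zero_right)

lemma hecke_expansion: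
  "h = (\<Sum>w\<in>Poly_Mapping.keys h. hscale (Poly_Mapping.lookup h w) (hT w))"
  by (rule poly_mapping_eqI)
    (auto simp: lookup_sum lookup_hT sum.delta' in_keys_iff if_distrib cong: if_cong)

lemma hecke_induct [case_names basis add scale]:
  assumes "\<And>w. P (hT w)" "\<And>g h. P g \<Longrightarrow> P h \<Longrightarrow> P (g + h)" "\<And>c h. P h \<Longrightarrow> P (hscale c h)"
  shows "P h"
proof -
  have "P (\<Sum>w\<in>S. hscale (Poly_Mapping.lookup h w) (hT w))" if "finite S" for S
    using that
  proof induction
    case empty
    show ?case using assms(3)[OF assms(1), of 0] by (simp add: hscale_zero)
  qed (auto intro: assms)
  then show ?thesis using hecke_expansion[of h] by (metis finite_keys)
qed

text \<open>The twist \<sigma> is the identity for multiplication operators and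
  \<open>laurent_bar\<close> for the bar involution, so both are treated at once.\<close>

definition semilinear :: "(laurent \<Rightarrow> laurent) \<Rightarrow> (hecke \<Rightarrow> hecke) \<Rightarrow> bool" where
  "semilinear \<sigma> F \<longleftrightarrow> (\<forall>g h. F (g + h) = F g + F h) \<and> (\<forall>c h. F (hscale c h) = hscale (\<sigma> c) (F h))"

lemma semilinear_add: "semilinear \<sigma> F \<Longrightarrow> F (g + h) = F g + F h"
  and semilinear_hscale: "semilinear \<sigma> F \<Longrightarrow> F (hscale c h) = hscale (\<sigma> c) (F h)"
  by (auto simp: semilinear_def)

lemma semilinear_zero: "semilinear \<sigma> F \<Longrightarrow> F 0 = 0"
  by (metis add_cancel_left_left semilinear_add)

lemma semilinear_diff: "semilinear \<sigma> F \<Longrightarrow> F (g - h) = F g - F h"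
  by (metis add_diff_cancel_right' diff_add_cancel semilinear_add)

lemma semilinear_sum: "semilinear \<sigma> F \<Longrightarrow> F (\<Sum>i\<in>I. f i) = (\<Sum>i\<in>I. F (f i))"
  by (induction I rule: infinite_finite_induct) (auto simp: semilinear_zero semilinear_add)

lemma semilinear_eqI:
  assumes "semilinear \<sigma> F" "semilinear \<sigma> G" "\<And>w. F (hT w) = G (hT w)"
  shows "F h = G h"
  by (induction h rule: hecke_induct)
    (use assms in \<open>simp_all add: semilinear_add[of \<sigma>] semilinear_hscale[of \<sigma>]\<close>)

lemma semilinear_comp:
  assumes "semilinear \<sigma> F" "semilinear \<tau> G" shows "semilinear (\<lambda>c. \<sigma> (\<tau> c)) (\<lambda>h. F (G h))"
  using assms by (simp add: semilinear_def)

lemma semilinear_foldr: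
  assumes "\<And>a. a \<in> set ss \<Longrightarrow> semilinear (\<lambda>c. c) (F a)"
  shows "semilinear (\<lambda>c. c) (foldr F ss)"
  using assms by (induction ss) (simp_all add: semilinear_def)

lemma semilinear_extension:
  assumes add: "\<And>x y. \<sigma> (x + y) = \<sigma> x + \<sigma> y" and mult: "\<And>x y. \<sigma> (x * y) = \<sigma> x * \<sigma> y"
  shows "semilinear \<sigma> (\<lambda>h. \<Sum>w\<in>Poly_Mapping.keys h. hscale (\<sigma> (Poly_Mapping.lookup h w)) (f w))"
    (is "semilinear \<sigma> ?F")
proof -
  have zero: "\<sigma> 0 = 0" using add[of 0 0] by simp
  \<comment> \<open>Sums and scalings may shrink the support by cancellation, so all sums are first
    taken over a common larger index set.\<close>
  have sup: "?F h = (\<Sum>w\<in>S. hscale (\<sigma> (Poly_Mapping.lookup h w)) (f w))"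
    if "finite S" "Poly_Mapping.keys h \<subseteq> S" for S h
    using that by (intro sum.mono_neutral_left) (auto simp: in_keys_iff zero hscale_zero)
  have "?F (g + h) = ?F g + ?F h" for g h
  proof -
    let ?S = "Poly_Mapping.keys g \<union> Poly_Mapping.keys h"
    have "?F (g + h) = (\<Sum>w\<in>?S. hscale (\<sigma> (Poly_Mapping.lookup (g + h) w)) (f w))"
      by (rule sup) (simp_all add: Poly_Mapping.keys_add)
    also have "... = ?F g + ?F h"
      by (simp add: sup[of ?S g] sup[of ?S h] lookup_add add hscale_add_left sum.distrib)
    finally show ?thesis .
  qed
  moreover have "?F (hscale c h) = hscale (\<sigma> c) (?F h)" for c h
  proof -
    have "?F (hscale c h) = (\<Sum>w\<in>Poly_Mapping.keys h. hscale (\<sigma> (Poly_Mapping.lookup (hscale c h) w)) (f w))"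
      by (rule sup) (auto simp: in_keys_iff)
    then show ?thesis by (simp add: mult hscale_sum hscale_hscale)
  qed
  ultimately show ?thesis by (simp add: semilinear_def)
qed

lemma extension_hT:
  assumes "\<sigma> 1 = 1"
  shows "(\<Sum>x\<in>Poly_Mapping.keys (hT w). hscale (\<sigma> (Poly_Mapping.lookup (hT w) x)) (f x)) = f w"
proof -
  have "Poly_Mapping.keys (hT w) = {w}" by (auto simp: hT_def)
  then show ?thesis using assms by (simp add: lookup_hT hscale_one)
qed

lemma semilinear_mult_Ts: "semilinear (\<lambda>c. c) (mult_Ts a)"
  unfolding mult_Ts_def[abs_def] by (rule semilinear_extension) auto

lemma mult_Ts_hT:
  "mult_Ts a (hT w) = (if len w < len (a * w) then hT (a * w)
     else hscale (hq - 1) (hT w) + hscale hq (hT (a * w)))"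
  unfolding mult_Ts_def by (rule extension_hT[where \<sigma> = "\<lambda>c. c"]) simp

lemmas mult_Ts_add = semilinear_add[OF semilinear_mult_Ts]
  and mult_Ts_diff = semilinear_diff[OF semilinear_mult_Ts]
  and mult_Ts_hscale = semilinear_hscale[OF semilinear_mult_Ts]

lemma mult_Ts_hT_up: "a \<in> simples \<Longrightarrow> \<not> down a w \<Longrightarrow> mult_Ts a (hT w) = hT (a * w)"
  by (simp add: mult_Ts_hT len_up)

lemma mult_Ts_hT_down:
  "a \<in> simples \<Longrightarrow> down a w \<Longrightarrow> mult_Ts a (hT w) = hscale (hq - 1) (hT w) + hscale hq (hT (a * w))"
  by (auto simp: mult_Ts_hT down_def)

text \<open>Reduces identities between multiplication operators to identities of coefficients, with
  a case split on descents only.\<close>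

lemma lookup_mult_Ts:
  assumes "a \<in> simples"
  shows "Poly_Mapping.lookup (mult_Ts a h) x =
    (if down a x then Poly_Mapping.lookup h (a * x) + (hq - 1) * Poly_Mapping.lookup h x
     else hq * Poly_Mapping.lookup h (a * x))"
proof (induction h rule: hecke_induct)
  case (basis w)
  have *: "a * x = w \<longleftrightarrow> x = a * w" using assms by auto
  have "a * w \<noteq> w" by (metis len_simple_mult_cases[OF assms] n_not_Suc_n)
  then show ?case
    using assms by (cases "down a w") (auto simp: mult_Ts_hT_up mult_Ts_hT_down lookup_add lookup_hT *)
qed (simp_all add: mult_Ts_add mult_Ts_hscale lookup_add algebra_simps)

lemma mult_Ts_quadratic:
  assumes "a \<in> simples"
  shows "mult_Ts a (mult_Ts a h) = hscale (hq - 1) (mult_Ts a h) + hscale hq h"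
  by (rule poly_mapping_eqI) (simp add: lookup_mult_Ts assms lookup_add algebra_simps)

section \<open>Right multiplication, as left multiplication conjugated by the anti-involution
  sending each basis element to that of the inverse\<close>

definition flip :: "hecke \<Rightarrow> hecke" where
  "flip h = Poly_Mapping.map_key winv h"

lemma lookup_flip [simp]: "Poly_Mapping.lookup (flip h) x = Poly_Mapping.lookup h (winv x)"
  unfolding flip_def using bij_winv by (subst map_key.rep_eq) (auto simp: bij_def)

lemma flip_flip [simp]: "flip (flip h) = h"
  by (rule poly_mapping_eqI) simp

lemma semilinear_flip: "semilinear (\<lambda>c. c) flip"
  unfolding semilinear_def by (auto intro!: poly_mapping_eqI simp: lookup_add)

lemma flip_hT [simp]: "flip (hT w) = hT (winv w)"
  by (rule poly_mapping_eqI) (auto simp: lookup_hT)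

definition mult_Ts_right :: "weyl \<Rightarrow> hecke \<Rightarrow> hecke" where
  "mult_Ts_right b h = flip (mult_Ts b (flip h))"

lemma semilinear_mult_Ts_right: "semilinear (\<lambda>c. c) (mult_Ts_right b)"
  by (simp add: semilinear_def mult_Ts_right_def mult_Ts_add mult_Ts_hscale
      semilinear_add[OF semilinear_flip] semilinear_hscale[OF semilinear_flip])

lemma lookup_mult_Ts_right:
  assumes "b \<in> simples"
  shows "Poly_Mapping.lookup (mult_Ts_right b h) x =
    (if down b (winv x) then Poly_Mapping.lookup h (x * b) + (hq - 1) * Poly_Mapping.lookup h x
     else hq * Poly_Mapping.lookup h (x * b))"
  using assms by (simp add: mult_Ts_right_def lookup_mult_Ts winv_mult)

lemma mult_Ts_commute:
  assumes "a \<in> simples" "b \<in> simples"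
  shows "mult_Ts a (mult_Ts_right b h) = mult_Ts_right b (mult_Ts a h)"
proof (rule poly_mapping_eqI)
  fix x
  show "Poly_Mapping.lookup (mult_Ts a (mult_Ts_right b h)) x =
        Poly_Mapping.lookup (mult_Ts_right b (mult_Ts a h)) x"
  proof (cases "a * x = x * b")
    \<comment> \<open>Here left multiplication by \<open>a\<close> and right multiplication by
      \<open>b\<close> move \<open>x\<close> to the same element, so their descent conditions agree
      at \<open>x\<close> and flip together.\<close>
    case True
    have axb: "a * (x * b) = x" "x * b * b = x"
      using assms True[symmetric] by (simp_all add: mult.assoc)
    have "len (b * winv x) = len (a * x)"
      using len_winv[of "x * b"] assms(2) True by (simp add: winv_mult)
    then have "down b (winv x) \<longleftrightarrow> down a x" by (simp add: down_def)
    moreover have "down a (x * b) \<longleftrightarrow> \<not> down a x" using assms True[symmetric] by simp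
    moreover have "down b (winv (x * b)) \<longleftrightarrow> \<not> down b (winv x)"
      using assms by (simp add: winv_mult)
    ultimately show ?thesis
      using assms True axb by (simp add: lookup_mult_Ts lookup_mult_Ts_right algebra_simps)
  next
    \<comment> \<open>Here each of the two multiplications leaves the descent condition of the other
      unchanged.\<close>
    case False
    then have "b * winv x \<noteq> winv x * a"
      using assms by (metis winv_eq_iff winv_mult winv_simple winv_winv)
    then have "down b (winv x * a) \<longleftrightarrow> down b (winv x)"
      using assms by (intro down_right_mult) auto
    then have "down b (winv (a * x)) \<longleftrightarrow> down b (winv x)" using assms by (simp add: winv_mult)
    moreover have "down a (x * b) \<longleftrightarrow> down a x" using assms False by (intro down_right_mult) auto
    ultimately show ?thesis
      using assms by (simp add: lookup_mult_Ts lookup_mult_Ts_right algebra_simps)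
  qed
qed

text \<open>Left multiplication by the inverse of the basis element of \<open>a\<close>, read off
  from the quadratic relation; \<open>qhalf_pow (- 2)\<close> is the inverse of
  \<open>q\<close>.\<close>

definition mult_Ts_inv :: "weyl \<Rightarrow> hecke \<Rightarrow> hecke" where
  "mult_Ts_inv a h = hscale (qhalf_pow (- 2)) (mult_Ts a h - hscale (hq - 1) h)"

lemma qhalf_pow_add: "qhalf_pow i * qhalf_pow j = qhalf_pow (i + j)"
  by (simp add: qhalf_pow_def mult_single)

lemma qhalf_pow_zero [simp]: "qhalf_pow 0 = 1"
  by (simp add: qhalf_pow_def)

lemma qinv_hq [simp]: "qhalf_pow (- 2) * hq = 1" "hq * qhalf_pow (- 2) = 1"
  by (simp_all add: hq_def qhalf_pow_add)

lemma semilinear_mult_Ts_inv: "semilinear (\<lambda>c. c) (mult_Ts_inv a)"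
  by (simp add: semilinear_def mult_Ts_inv_def mult_Ts_add mult_Ts_hscale hscale_add hscale_diff
      hscale_hscale algebra_simps)

lemma mult_Ts_mult_Ts_inv: "a \<in> simples \<Longrightarrow> mult_Ts a (mult_Ts_inv a h) = h"
  by (simp add: mult_Ts_inv_def mult_Ts_diff mult_Ts_hscale mult_Ts_quadratic hscale_hscale hscale_one)

lemma mult_Ts_inv_mult_Ts: "a \<in> simples \<Longrightarrow> mult_Ts_inv a (mult_Ts a h) = h"
  by (simp add: mult_Ts_inv_def mult_Ts_quadratic hscale_hscale hscale_one)

lemma mult_Ts_inv_quadratic:
  assumes "a \<in> simples"
  shows "mult_Ts_inv a (mult_Ts_inv a h) =
    hscale (qhalf_pow (- 2) - 1) (mult_Ts_inv a h) + hscale (qhalf_pow (- 2)) h"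
proof -
  have "mult_Ts_inv a (mult_Ts_inv a h) =
      hscale (qhalf_pow (- 2)) (h - hscale (hq - 1) (mult_Ts_inv a h))"
    using assms mult_Ts_mult_Ts_inv by (metis mult_Ts_inv_def)
  then show ?thesis
    by (simp add: hscale_diff hscale_hscale right_diff_distrib hscale_diff_left hscale_one)
qed

lemma foldr_mult_Ts_hT_one: "reduced_expression ss w \<Longrightarrow> foldr mult_Ts ss (hT 1) = hT w"
proof (induction ss arbitrary: w)
  case Nil
  then show ?case by (simp add: reduced_expression_def expression_def)
next
  case (Cons a ss)
  then have "a \<in> simples" "down a w" "foldr mult_Ts ss (hT 1) = hT (a * w)"
    by (auto simp: reduced_expression_Cons)
  then show ?case using mult_Ts_hT_up[of a "a * w"] by simp
qed

lemma hT_eq_foldr_right: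
  assumes "reduced_expression ss (winv w)"
  shows "hT w = foldr mult_Ts_right ss (hT 1)"
proof -
  have "mult_Ts_right a (flip h) = flip (mult_Ts a h)" for a h
    by (simp add: mult_Ts_right_def)
  then have "foldr mult_Ts_right ss (flip h) = flip (foldr mult_Ts ss h)" for h
    by (induction ss) simp_all
  from this[of "hT 1"] show ?thesis using foldr_mult_Ts_hT_one[OF assms] by simp
qed

lemma foldr_mult_Ts_commute:
  assumes "set ss \<subseteq> simples" "set rs \<subseteq> simples"
  shows "foldr mult_Ts ss (foldr mult_Ts_right rs h) = foldr mult_Ts_right rs (foldr mult_Ts ss h)"
proof -
  have "mult_Ts a (foldr mult_Ts_right rs h) = foldr mult_Ts_right rs (mult_Ts a h)"
    if "a \<in> simples" for a h
    using assms(2) by (induction rs) (simp_all add: mult_Ts_commute that)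
  then show ?thesis using assms(1) by (induction ss) simp_all
qed

lemma reduced_expression_simples: "reduced_expression ss w \<Longrightarrow> set ss \<subseteq> simples"
  by (simp add: reduced_expression_def expression_def)

text \<open>Both operators commute with all right multiplications, and every \<open>hT y\<close>
  arises from \<open>hT 1\<close> by right multiplications. Hence they are determined by their
  common value \<open>hT w\<close> at \<open>hT 1\<close>.\<close>

lemma foldr_mult_Ts_reduced:
  assumes "reduced_expression ss w" "reduced_expression ss' w"
  shows "foldr mult_Ts ss h = foldr mult_Ts ss' h"
proof (rule semilinear_eqI[of "\<lambda>c. c" "foldr mult_Ts ss" "foldr mult_Ts ss'"])
  fix y
  obtain rs where rs: "reduced_expression rs (winv y)" using reduced_expression_exists by blast
  show "foldr mult_Ts ss (hT y) = foldr mult_Ts ss' (hT y)"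
    unfolding hT_eq_foldr_right[OF rs]
    using assms rs by (simp add: foldr_mult_Ts_commute reduced_expression_simples foldr_mult_Ts_hT_one)
qed (auto intro: semilinear_foldr semilinear_mult_Ts)

lemma mult_T_reduced:
  assumes "reduced_expression ss w" shows "mult_T w h = foldr mult_Ts ss h"
  unfolding mult_T_def
  by (rule foldr_mult_Ts_reduced[OF someI[of "\<lambda>ss. reduced_expression ss w", OF assms] assms])

lemma mult_T_one [simp]: "mult_T 1 h = h"
  using mult_T_reduced[of "[]" 1] by (simp add: reduced_expression_def expression_def)

lemma mult_T_up:
  assumes "a \<in> simples" "\<not> down a w" shows "mult_T (a * w) h = mult_Ts a (mult_T w h)"
proof -
  obtain ss where ss: "reduced_expression ss w" using reduced_expression_exists by blast
  then have "reduced_expression (a # ss) (a * w)" using assms by (simp add: reduced_expression_Cons)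
  then show ?thesis using ss by (simp add: mult_T_reduced)
qed

lemma semilinear_hecke_mult: "semilinear (\<lambda>c. c) (\<lambda>g. hecke_mult g h)"
  unfolding hecke_mult_def by (rule semilinear_extension) auto

lemma hecke_mult_hT: "hecke_mult (hT w) h = mult_T w h"
  unfolding hecke_mult_def by (rule extension_hT[where \<sigma> = "\<lambda>c. c"]) simp

lemmas hecke_mult_add = semilinear_add[OF semilinear_hecke_mult]
  and hecke_mult_diff = semilinear_diff[OF semilinear_hecke_mult]
  and hecke_mult_hscale = semilinear_hscale[OF semilinear_hecke_mult]

text \<open>The case of associativity where the leftmost factor is a generator; the general case
  follows along a reduced expression.\<close>

lemma hecke_mult_mult_Ts:
  assumes a: "a \<in> simples"
  shows "hecke_mult (mult_Ts a g) h = mult_Ts a (hecke_mult g h)"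
proof (induction g rule: hecke_induct)
  case (basis w)
  show ?case
  proof (cases "down a w")
    case False
    then show ?thesis using a by (simp add: mult_Ts_hT_up hecke_mult_hT mult_T_up)
  next
    case True
    have "mult_T w h = mult_Ts a (mult_T (a * w) h)"
      using mult_T_up[of a "a * w" h] a True by simp
    then show ?thesis
      using a True by (simp add: mult_Ts_hT_down hecke_mult_add hecke_mult_hscale hecke_mult_hT
          mult_Ts_quadratic)
  qed
qed (simp_all add: mult_Ts_add mult_Ts_hscale hecke_mult_add hecke_mult_hscale)

lemma hecke_mult_mult_Ts_inv:
  assumes "a \<in> simples"
  shows "hecke_mult (mult_Ts_inv a g) h = mult_Ts_inv a (hecke_mult g h)"
  using assms by (simp add: mult_Ts_inv_def hecke_mult_hscale hecke_mult_diff hecke_mult_mult_Ts)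

lemma hecke_mult_one_left [simp]: "hecke_mult (hT 1) h = h"
  by (simp add: hecke_mult_hT)

lemma mult_T_hT_one: "mult_T w (hT 1) = hT w"
  using reduced_expression_exists[of w] by (auto simp: mult_T_reduced foldr_mult_Ts_hT_one)

lemma hecke_mult_one_right [simp]: "hecke_mult h (hT 1) = h"
  by (induction h rule: hecke_induct)
    (simp_all add: hecke_mult_hT mult_T_hT_one hecke_mult_add hecke_mult_hscale)

lemma hecke_mult_foldr:
  assumes "set ss \<subseteq> simples"
  shows "hecke_mult (foldr mult_Ts ss g) h = foldr mult_Ts ss (hecke_mult g h)"
    "hecke_mult (foldr mult_Ts_inv ss g) h = foldr mult_Ts_inv ss (hecke_mult g h)"
  using assms by (induction ss) (simp_all add: hecke_mult_mult_Ts hecke_mult_mult_Ts_inv)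

lemma hecke_mult_assoc: "hecke_mult (hecke_mult f g) h = hecke_mult f (hecke_mult g h)"
proof (induction f rule: hecke_induct)
  case (basis w)
  obtain ss where ss: "reduced_expression ss w" using reduced_expression_exists by blast
  then show ?case
    by (simp add: hecke_mult_hT mult_T_reduced hecke_mult_foldr reduced_expression_simples)
qed (simp_all add: hecke_mult_add hecke_mult_hscale)

lemma foldr_mult_Ts_cancel:
  assumes "set ss \<subseteq> simples"
  shows "foldr mult_Ts ss (foldr mult_Ts_inv (rev ss) h) = h"
    "foldr mult_Ts_inv (rev ss) (foldr mult_Ts ss h) = h"
  using assms by (induction ss arbitrary: h) (simp_all add: mult_Ts_mult_Ts_inv mult_Ts_inv_mult_Ts)

text \<open>The inverses are applied in reverse order. Associativity makes the two-sided inverse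
  unique, which resolves the definite description.\<close>

lemma hecke_inverse_hT:
  assumes "reduced_expression ss w"
  shows "hecke_inverse (hT w) = foldr mult_Ts_inv (rev ss) (hT 1)"
proof -
  define g where "g = foldr mult_Ts_inv (rev ss) (hT 1)"
  have s: "set ss \<subseteq> simples" "set (rev ss) \<subseteq> simples"
    using assms by (auto dest: reduced_expression_simples)
  have 1: "hecke_mult (hT w) g = hT 1"
    unfolding hecke_mult_hT mult_T_reduced[OF assms] g_def using s by (simp add: foldr_mult_Ts_cancel)
  have "hecke_mult g (hT w) = foldr mult_Ts_inv (rev ss) (foldr mult_Ts ss (hT 1))"
    unfolding g_def hecke_mult_foldr(2)[OF s(2)] by (simp add: foldr_mult_Ts_hT_one[OF assms])
  then have 2: "hecke_mult g (hT w) = hT 1" using s by (simp add: foldr_mult_Ts_cancel)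
  have "hecke_inverse (hT w) = g"
    unfolding hecke_inverse_def
  proof (rule the_equality)
    fix f assume f: "hecke_mult (hT w) f = hT 1 \<and> hecke_mult f (hT w) = hT 1"
    have "f = hecke_mult (hecke_mult g (hT w)) f" by (simp add: 2)
    also have "... = g" using f by (simp add: hecke_mult_assoc)
    finally show "f = g" .
  qed (simp add: 1 2)
  then show ?thesis by (simp add: g_def)
qed

section \<open>The bar involution on scalars and on the Hecke algebra\<close>

lemma lookup_laurent_bar [simp]: "Poly_Mapping.lookup (laurent_bar f) k = Poly_Mapping.lookup f (- k)"
  unfolding laurent_bar_def by (subst map_key.rep_eq) auto

lemma laurent_bar_add: "laurent_bar (f + g) = laurent_bar f + laurent_bar g"
  and laurent_bar_zero: "laurent_bar 0 = 0"
  and laurent_bar_diff: "laurent_bar (f - g) = laurent_bar f - laurent_bar g"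
  by (rule poly_mapping_eqI; simp add: lookup_add lookup_minus)+

lemma laurent_bar_single: "laurent_bar (Poly_Mapping.single k c) = Poly_Mapping.single (- k) c"
  by (rule poly_mapping_eqI) (auto simp: lookup_single when_def)

lemma laurent_bar_qhalf_pow [simp]: "laurent_bar (qhalf_pow k) = qhalf_pow (- k)"
  by (simp add: qhalf_pow_def laurent_bar_single)

lemma laurent_bar_one [simp]: "laurent_bar 1 = 1"
  using laurent_bar_qhalf_pow[of 0] by simp

lemma laurent_bar_sum: "laurent_bar (\<Sum>i\<in>I. f i) = (\<Sum>i\<in>I. laurent_bar (f i))"
  by (induction I rule: infinite_finite_induct) (auto simp: laurent_bar_add laurent_bar_zero)

lemma laurent_bar_mult: "laurent_bar (f * g) = laurent_bar f * laurent_bar g"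
proof -
  have e: "f = (\<Sum>k\<in>Poly_Mapping.keys f. Poly_Mapping.single k (Poly_Mapping.lookup f k))" for f :: laurent
    by (rule poly_mapping_eqI) (auto simp: lookup_sum lookup_single when_def sum.delta' in_keys_iff cong: if_cong)
  define F G where "F k = Poly_Mapping.single k (Poly_Mapping.lookup f k)"
    and "G k = Poly_Mapping.single k (Poly_Mapping.lookup g k)" for k
  define A B where "A = Poly_Mapping.keys f" and "B = Poly_Mapping.keys g"
  have FG: "laurent_bar (F k * G l) = laurent_bar (F k) * laurent_bar (G l)" for k l
    by (simp add: F_def G_def mult_single laurent_bar_single)
  have f: "f = sum F A" and g: "g = sum G B" using e by (simp_all add: F_def G_def A_def B_def)
  show ?thesis unfolding f g by (simp add: laurent_bar_sum sum_product FG)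
qed

lemma semilinear_hecke_bar: "semilinear laurent_bar hecke_bar"
  unfolding hecke_bar_def[abs_def] by (rule semilinear_extension) (auto simp: laurent_bar_add laurent_bar_mult)

lemmas hecke_bar_add = semilinear_add[OF semilinear_hecke_bar]
  and hecke_bar_diff = semilinear_diff[OF semilinear_hecke_bar]
  and hecke_bar_sum = semilinear_sum[OF semilinear_hecke_bar]
  and hecke_bar_hscale = semilinear_hscale[OF semilinear_hecke_bar]

text \<open>Inverting the group element and inverting its basis element each reverse the word, so
  the letters end up in their original order.\<close>

lemma hecke_bar_hT:
  assumes "reduced_expression ss w" shows "hecke_bar (hT w) = foldr mult_Ts_inv ss (hT 1)"
proof -
  have "hecke_bar (hT w) = hecke_inverse (hT (winv w))"
    unfolding hecke_bar_def by (rule extension_hT[where \<sigma> = laurent_bar]) simp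
  then show ?thesis using hecke_inverse_hT[OF reduced_expression_rev[OF assms]] by simp
qed

lemma hecke_bar_hT_one: "hecke_bar (hT 1) = hT 1"
  using hecke_bar_hT[of "[]" 1] by (simp add: reduced_expression_def expression_def)

lemma hecke_bar_hT_up:
  assumes "a \<in> simples" "\<not> down a w"
  shows "hecke_bar (hT (a * w)) = mult_Ts_inv a (hecke_bar (hT w))"
proof -
  obtain ss where ss: "reduced_expression ss w" using reduced_expression_exists by blast
  then have "reduced_expression (a # ss) (a * w)" using assms by (simp add: reduced_expression_Cons)
  then show ?thesis using ss by (simp add: hecke_bar_hT)
qed

text \<open>On a basis element lengthened by \<open>a\<close> this is the expression above; on one
  shortened by \<open>a\<close> it amounts to the quadratic relation for the inverse
  operator.\<close>

lemma hecke_bar_mult_Ts: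
  assumes a: "a \<in> simples"
  shows "hecke_bar (mult_Ts a h) = mult_Ts_inv a (hecke_bar h)"
proof (rule semilinear_eqI[of laurent_bar "\<lambda>h. hecke_bar (mult_Ts a h)" "\<lambda>h. mult_Ts_inv a (hecke_bar h)"])
  show "semilinear laurent_bar (\<lambda>h. hecke_bar (mult_Ts a h))"
    using semilinear_comp[OF semilinear_hecke_bar semilinear_mult_Ts] by simp
  show "semilinear laurent_bar (\<lambda>h. mult_Ts_inv a (hecke_bar h))"
    using semilinear_comp[OF semilinear_mult_Ts_inv semilinear_hecke_bar] by simp
  fix w
  show "hecke_bar (mult_Ts a (hT w)) = mult_Ts_inv a (hecke_bar (hT w))"
  proof (cases "down a w")
    case False
    then show ?thesis using a by (simp add: mult_Ts_hT_up hecke_bar_hT_up)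
  next
    case True
    have "hecke_bar (hT w) = mult_Ts_inv a (hecke_bar (hT (a * w)))"
      using hecke_bar_hT_up[of a "a * w"] a True by simp
    then show ?thesis
      using a True by (simp add: mult_Ts_hT_down hecke_bar_add hecke_bar_hscale mult_Ts_inv_quadratic
          laurent_bar_diff hq_def)
  qed
qed

lemma hecke_bar_flip: "hecke_bar (flip h) = flip (hecke_bar h)"
proof (rule semilinear_eqI[of laurent_bar "\<lambda>h. hecke_bar (flip h)" "\<lambda>h. flip (hecke_bar h)"])
  show "semilinear laurent_bar (\<lambda>h. hecke_bar (flip h))"
    using semilinear_comp[OF semilinear_hecke_bar semilinear_flip] by simp
  show "semilinear laurent_bar (\<lambda>h. flip (hecke_bar h))"
    using semilinear_comp[OF semilinear_flip semilinear_hecke_bar] by simp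
  fix w
  obtain ss where ss: "reduced_expression ss w" using reduced_expression_exists by blast
  \<comment> \<open>Right multiplication by the inverse of the basis element of
    \<open>a\<close>.\<close>
  define ri where "ri a h = flip (mult_Ts_inv a (flip h))" for a h
  have ri: "ri a h = hscale (qhalf_pow (- 2)) (mult_Ts_right a h - hscale (hq - 1) h)" for a h
    by (rule poly_mapping_eqI) (simp add: ri_def mult_Ts_inv_def mult_Ts_right_def lookup_minus)
  have comm: "mult_Ts_inv a (ri b h) = ri b (mult_Ts_inv a h)"
    if "a \<in> simples" "b \<in> simples" for a b h
    using that
    by (simp add: ri mult_Ts_inv_def mult_Ts_diff mult_Ts_hscale mult_Ts_commute hscale_diff hscale_hscale
        semilinear_diff[OF semilinear_mult_Ts_right] semilinear_hscale[OF semilinear_mult_Ts_right]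
        algebra_simps)
  have one: "ri a (hT 1) = mult_Ts_inv a (hT 1)" if "a \<in> simples" for a
    using that by (simp add: ri mult_Ts_inv_def mult_Ts_right_def mult_Ts_hT_up)
  have move: "foldr ri ss (mult_Ts_inv a h) = mult_Ts_inv a (foldr ri ss h)"
    if "set ss \<subseteq> simples" "a \<in> simples" for ss a h
    using that by (induction ss) (simp_all add: comm)
  \<comment> \<open>Starting from the unit, a product may be built from either side, at the price of
    reversing the order of the factors.\<close>
  have rev: "foldr ri ss (hT 1) = foldr mult_Ts_inv (rev ss) (hT 1)" if "set ss \<subseteq> simples" for ss
    using that
  proof (induction ss rule: rev_induct)
    case (snoc a ss)
    then show ?case by (simp add: one move)
  qed simp
  have "ri a (flip h) = flip (mult_Ts_inv a h)" for a h
    by (simp add: ri_def)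
  then have "foldr ri ss (flip h) = flip (foldr mult_Ts_inv ss h)" for ss h
    by (induction ss) simp_all
  from this[of ss "hT 1"]  have "flip (hecke_bar (hT w)) = foldr ri ss (hT 1)"
    by (simp add: hecke_bar_hT[OF ss])
  also have "... = hecke_bar (flip (hT w))"
    using rev[OF reduced_expression_simples[OF ss]] hecke_bar_hT[OF reduced_expression_rev[OF ss]] by simp
  finally show "hecke_bar (flip (hT w)) = flip (hecke_bar (hT w))" ..
qed

subsection \<open>Kazhdan--Lusztig polynomials\<close>

lemma lookup_single_mult:
  "Poly_Mapping.lookup (Poly_Mapping.single m c * f) k = c * Poly_Mapping.lookup f (k - m)"
  for f :: laurent
proof -
  define F where "F j = Poly_Mapping.single j (Poly_Mapping.lookup f j)" for j
  define A where "A = Poly_Mapping.keys f"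
  have f: "f = sum F A"
    by (rule poly_mapping_eqI)
      (auto simp: F_def A_def lookup_sum lookup_single when_def sum.delta' in_keys_iff cong: if_cong)
  have "Poly_Mapping.lookup (Poly_Mapping.single m c * sum F A) k =
      (\<Sum>j\<in>A. if j = k - m then c * Poly_Mapping.lookup f (k - m) else 0)"
    unfolding sum_distrib_left lookup_sum
    by (intro sum.cong) (auto simp: F_def mult_single lookup_single when_def)
  also have "... = c * Poly_Mapping.lookup f (k - m)"
    by (auto simp: A_def in_keys_iff sum.delta)
  finally show ?thesis using f by simp
qed

lemma lookup_laurent_of_poly:
  "Poly_Mapping.lookup (laurent_of_poly p) k =
    (if 0 \<le> k \<and> even k then coeff p (nat (k div 2)) else 0)"
proof -
  have "Poly_Mapping.lookup (laurent_of_poly p) k =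
      (\<Sum>i\<le>degree p. if 2 * int i = k then coeff p i else 0)"
    by (simp add: laurent_of_poly_def lookup_sum lookup_single when_def)
  also have "... = (if 0 \<le> k \<and> even k then coeff p (nat (k div 2)) else 0)"
  proof (cases "0 \<le> k \<and> even k")
    case True
    then have "2 * int i = k \<longleftrightarrow> i = nat (k div 2)" for i by auto
    then show ?thesis using True by (simp add: sum.delta' coeff_eq_0)
  next
    case False
    then have "2 * int i \<noteq> k" for i by auto
    then show ?thesis by (simp add: if_not_P[OF False])
  qed
  finally show ?thesis .
qed

lemma laurent_of_poly_add: "laurent_of_poly (p + q) = laurent_of_poly p + laurent_of_poly q"
  and laurent_of_poly_diff: "laurent_of_poly (p - q) = laurent_of_poly p - laurent_of_poly q"
  and laurent_of_poly_zero [simp]: "laurent_of_poly 0 = 0"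
  by (rule poly_mapping_eqI; simp add: lookup_laurent_of_poly lookup_add lookup_minus)+

lemma laurent_of_poly_sum: "laurent_of_poly (\<Sum>i\<in>I. f i) = (\<Sum>i\<in>I. laurent_of_poly (f i))"
  by (induction I rule: infinite_finite_induct) (auto simp: laurent_of_poly_add)

lemma laurent_of_poly_one [simp]: "laurent_of_poly 1 = 1"
  by (simp add: laurent_of_poly_def)

lemma laurent_of_poly_inject: "laurent_of_poly p = laurent_of_poly q \<longleftrightarrow> p = q"
proof
  assume eq: "laurent_of_poly p = laurent_of_poly q"
  show "p = q"
  proof (rule poly_eqI)
    fix i
    have "Poly_Mapping.lookup (laurent_of_poly p) (2 * int i) = Poly_Mapping.lookup (laurent_of_poly q) (2 * int i)"
      by (simp add: eq)
    then show "coeff p i = coeff q i" by (simp add: lookup_laurent_of_poly)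
  qed
qed simp

lemma laurent_of_poly_monom_mult:
  "laurent_of_poly (monom c i * p) = Poly_Mapping.single (2 * int i) c * laurent_of_poly p"
proof (rule poly_mapping_eqI)
  fix k
  have "nat ((k - 2 * int i) div 2) = nat (k div 2) - i" if ev: "even k"
  proof -
    obtain j where "k = 2 * j" using ev by (auto elim: evenE)
    then have "(k - 2 * int i) div 2 = j - int i" "k div 2 = j" by auto
    then show ?thesis by linarith
  qed
  then show "Poly_Mapping.lookup (laurent_of_poly (monom c i * p)) k =
      Poly_Mapping.lookup (Poly_Mapping.single (2 * int i) c * laurent_of_poly p) k"
    by (auto simp: lookup_single_mult lookup_laurent_of_poly coeff_monom_mult)
qed

lemma lookup_kl_element:
  assumes "\<And>y. \<not> y \<le> w \<Longrightarrow> P y = 0"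
  shows "Poly_Mapping.lookup (kl_element w P) x = qhalf_pow (- int (len w)) * laurent_of_poly (P x)"
proof -
  have "(\<Sum>y | y \<le> w. laurent_of_poly (P y) * (if x = y then 1 else 0)) = laurent_of_poly (P x)"
    using finite_le[of w] assms[of x] by (simp add: if_distrib sum.delta cong: if_cong)
  then show ?thesis by (simp add: kl_element_def lookup_sum lookup_hT)
qed

section \<open>Triangularity of the bar involution and uniqueness of Kazhdan-Lusztig
  families\<close>

lemma lookup_mult_Ts_inv:
  assumes "a \<in> simples"
  shows "Poly_Mapping.lookup (mult_Ts_inv a h) x =
    (if down a x then qhalf_pow (- 2) * Poly_Mapping.lookup h (a * x)
     else Poly_Mapping.lookup h (a * x) - (1 - qhalf_pow (- 2)) * Poly_Mapping.lookup h x)"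
proof -
  have "qhalf_pow (- 2) * (hq * c) = c" for c by (simp add: mult.assoc[symmetric])
  note * = this[of "Poly_Mapping.lookup h x"] this[of "Poly_Mapping.lookup h (a * x)"]
  show ?thesis using assms
    by (simp add: * mult_Ts_inv_def lookup_mult_Ts lookup_minus left_diff_distrib right_diff_distrib
        distrib_left)
qed

lemma down_exists: "w \<noteq> 1 \<Longrightarrow> \<exists>a\<in>simples. down a w"
proof -
  assume "w \<noteq> 1"
  obtain ss where ss: "reduced_expression ss w" using reduced_expression_exists by blast
  then obtain a ts where "ss = a # ts"
    using \<open>w \<noteq> 1\<close> by (cases ss) (auto simp: reduced_expression_def expression_def)
  then show ?thesis using ss by (auto simp: reduced_expression_Cons)
qed

lemma hecke_bar_hT_triangular:
  "Poly_Mapping.lookup (hecke_bar (hT w)) w = qhalf_pow (- 2 * int (len w))"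
  "Poly_Mapping.lookup (hecke_bar (hT w)) x \<noteq> 0 \<Longrightarrow> x = w \<or> len x < len w"
proof (induction "len w" arbitrary: w x)
  case 0
  { case 1 show ?case using 0 by (simp add: hecke_bar_hT_one lookup_hT) }
  { case 2 then show ?case using 0 by (simp add: hecke_bar_hT_one lookup_hT split: if_splits) }
next
  case (Suc n)
  then have "w \<noteq> 1" by auto
  then obtain a where a: "a \<in> simples" "down a w" using down_exists by blast
  define v where "v = a * w"
  have v: "len w = Suc (len v)" "\<not> down a v" "w = a * v" "n = len v"
    using a len_down[OF a] Suc.hyps(3) by (auto simp: v_def)
  have bar: "hecke_bar (hT w) = mult_Ts_inv a (hecke_bar (hT v))"
    using hecke_bar_hT_up[OF a(1) v(2)] v(3) by simp
  { case 1
    have "Poly_Mapping.lookup (hecke_bar (hT w)) w =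
        qhalf_pow (- 2) * Poly_Mapping.lookup (hecke_bar (hT v)) v"
      unfolding bar using a by (simp add: lookup_mult_Ts_inv v_def)
    then show ?case
      using Suc.hyps(1)[OF v(4)] v(1) by (simp add: qhalf_pow_add) }
  { case 2
    then have "Poly_Mapping.lookup (hecke_bar (hT v)) (a * x) \<noteq> 0 \<or>
        (\<not> down a x \<and> Poly_Mapping.lookup (hecke_bar (hT v)) x \<noteq> 0)"
      using a by (auto simp: bar lookup_mult_Ts_inv split: if_splits)
    then have "a * x = v \<or> len (a * x) < len v \<or> x = v \<or> len x < len v"
      using Suc.hyps(2)[OF v(4)] by blast
    then show ?case
      using v(1,3) a(1) len_simple_mult_le[OF a(1), of "a * x"] by auto }
qed

text \<open>At an element of maximal length in the support the bar involution only reflects the exponents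
  about \<open>- len x\<close>, which the hypothesis on the exponents forbids.\<close>

lemma hecke_bar_invariant_eq_0:
  assumes "hecke_bar D = D"
    and "\<And>x k. Poly_Mapping.lookup (Poly_Mapping.lookup D x) k \<noteq> 0 \<Longrightarrow> k < - int (len x)"
  shows "D = 0"
proof (rule ccontr)
  assume "D \<noteq> 0"
  then have ne: "Poly_Mapping.keys D \<noteq> {}" by simp
  define m where "m = Max (len ` Poly_Mapping.keys D)"
  have "m \<in> len ` Poly_Mapping.keys D" unfolding m_def using ne by (intro Max_in) auto
  then obtain x where x: "x \<in> Poly_Mapping.keys D" "len x = m" by auto
  have max: "len w \<le> len x" if "w \<in> Poly_Mapping.keys D" for w
    using that x(2) by (simp add: m_def)
  define f where "f = Poly_Mapping.lookup D x"
  have "Poly_Mapping.lookup (hecke_bar (\<Sum>w\<in>Poly_Mapping.keys D. hscale (Poly_Mapping.lookup D w) (hT w))) x =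
      (\<Sum>w\<in>Poly_Mapping.keys D.
        laurent_bar (Poly_Mapping.lookup D w) * Poly_Mapping.lookup (hecke_bar (hT w)) x)"
    by (simp add: hecke_bar_sum hecke_bar_hscale lookup_sum)
  then have "f = (\<Sum>w\<in>Poly_Mapping.keys D.
      laurent_bar (Poly_Mapping.lookup D w) * Poly_Mapping.lookup (hecke_bar (hT w)) x)"
    unfolding hecke_expansion[symmetric] assms(1) f_def .
  also have "... = (\<Sum>w\<in>Poly_Mapping.keys D. if w = x then laurent_bar f * qhalf_pow (- 2 * int (len x)) else 0)"
  proof (rule sum.cong[OF HOL.refl])
    fix w assume "w \<in> Poly_Mapping.keys D"
    then have "w = x \<or> Poly_Mapping.lookup (hecke_bar (hT w)) x = 0"
      using max[of w] hecke_bar_hT_triangular(2)[of w x] by fastforce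
    then show "laurent_bar (Poly_Mapping.lookup D w) * Poly_Mapping.lookup (hecke_bar (hT w)) x =
        (if w = x then laurent_bar f * qhalf_pow (- 2 * int (len x)) else 0)"
      using hecke_bar_hT_triangular(1)[of x] by (auto simp: f_def)
  qed
  also have "... = qhalf_pow (- 2 * int (len x)) * laurent_bar f"
    using x(1) by (simp add: mult.commute)
  finally have sym: "Poly_Mapping.lookup f k = Poly_Mapping.lookup f (- k - 2 * int (len x))" for k
    using lookup_single_mult[of "- 2 * int (len x)" 1 "laurent_bar f" k]
    by (simp add: qhalf_pow_def algebra_simps)
  have "f \<noteq> 0" using x(1) by (simp add: f_def in_keys_iff)
  then obtain k where k: "Poly_Mapping.lookup f k \<noteq> 0" by (metis poly_mapping_eqI lookup_zero)
  then have "k < - int (len x)" "- k - 2 * int (len x) < - int (len x)"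
    using assms(2)[of x] sym[of k] by (auto simp: f_def)
  then show False by simp
qed

text \<open>The difference of two candidates vanishes at \<open>w\<close>. Below \<open>w\<close>
  the degree bound puts its exponents \<open>2i - len w\<close> under \<open>- len x\<close>, so the
  bar-invariance argument kills it.\<close>

lemma is_kl_family_unique:
  assumes P: "is_kl_family w P" and Q: "is_kl_family w Q"
  shows "P = Q"
proof -
  have zero: "\<And>y. \<not> y \<le> w \<Longrightarrow> P y = 0" "\<And>y. \<not> y \<le> w \<Longrightarrow> Q y = 0"
    using P Q by (auto simp: is_kl_family_def)
  define D where "D = kl_element w P - kl_element w Q"
  have lookup_D: "Poly_Mapping.lookup D x = qhalf_pow (- int (len w)) * laurent_of_poly (P x - Q x)" for x
    by (simp add: D_def lookup_minus lookup_kl_element zero laurent_of_poly_diff right_diff_distrib)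
  have "D = 0"
  proof (rule hecke_bar_invariant_eq_0)
    show "hecke_bar D = D" using P Q by (simp add: D_def hecke_bar_diff is_kl_family_def)
    fix x k assume "Poly_Mapping.lookup (Poly_Mapping.lookup D x) k \<noteq> 0"
    then have k: "0 \<le> k + int (len w)" "even (k + int (len w))"
        "coeff (P x - Q x) (nat ((k + int (len w)) div 2)) \<noteq> 0"
      by (auto simp: lookup_D qhalf_pow_def lookup_single_mult lookup_laurent_of_poly split: if_splits)
    define i where "i = nat ((k + int (len w)) div 2)"
    have ik: "2 * int i = k + int (len w)" using k by (simp add: i_def)
    have "coeff (P x) i \<noteq> 0 \<or> coeff (Q x) i \<noteq> 0" using k(3) by (auto simp: i_def)
    then have i: "i \<le> degree (P x) \<or> i \<le> degree (Q x)" by (auto intro: le_degree)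
    have "x < w"
      using k(3) zero[of x] P Q by (auto simp: less_weyl_def is_kl_family_def)
    then have "2 * degree (P x) + 1 \<le> len w - len x" "2 * degree (Q x) + 1 \<le> len w - len x"
      using P Q by (auto simp: is_kl_family_def)
    with i ik show "k < - int (len x)" by linarith
  qed
  have "P x = Q x" for x
  proof -
    have "qhalf_pow (int (len w)) * (qhalf_pow (- int (len w)) * laurent_of_poly (P x - Q x)) = 0"
      using lookup_D[of x] \<open>D = 0\<close> by simp
    then have "laurent_of_poly (P x - Q x) = laurent_of_poly 0"
      by (simp add: mult.assoc[symmetric] qhalf_pow_add)
    then show ?thesis by (simp add: laurent_of_poly_inject del: laurent_of_poly_zero)
  qed
  then show ?thesis by auto
qed

lemma is_kl_family_imp_kl_poly:
  assumes "is_kl_family w P"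
  shows "kl_poly y w = P y"
  unfolding kl_poly_def using assms is_kl_family_unique by (metis (mono_tags, lifting) the_equality)

text \<open>The coefficients, after normalisation, of the product of the Kazhdan-Lusztig elements of
  \<open>a\<close> and \<open>v\<close>, corrected by \<open>mu z v\<close> times that of
  \<open>z\<close> for each relevant \<open>z\<close>. The monomial exponent is half of
  \<open>len (a * v) - len z\<close> when \<open>a\<close> is not a descent of
  \<open>v\<close>.\<close>

definition kl_rec :: "weyl \<Rightarrow> weyl \<Rightarrow> weyl \<Rightarrow> int poly" where
  "kl_rec a v y =
    (if down a y then kl_poly (a * y) v + monom 1 1 * kl_poly y v
     else kl_poly y v + monom 1 1 * kl_poly (a * y) v)
    - (\<Sum>z | z < v \<and> down a z \<and> odd (len v - len z).
        monom (mu z v) ((Suc (len v) - len z) div 2) * kl_poly y z)"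

lemma finite_less: "finite {z. z < (v::weyl) \<and> Q z}"
  by (rule finite_subset[OF _ finite_le[of v]]) (auto simp: less_weyl_def)

lemma coeff_kl_poly_nonzero:
  assumes "is_kl_family z (\<lambda>y. kl_poly y z)" "coeff (kl_poly x z) i \<noteq> 0"
  shows "x = z \<and> i = 0 \<or> x < z \<and> 2 * i + 1 \<le> len z - len x"
proof (cases "x = z")
  case True
  then have "kl_poly x z = 1" using assms(1) by (simp add: is_kl_family_def)
  then show ?thesis using assms(2) True by (auto simp: coeff_1 split: if_splits)
next
  case False
  then have "x < z" using assms by (auto simp: is_kl_family_def less_weyl_def)
  moreover have "2 * degree (kl_poly x z) + 1 \<le> len z - len x"
    using assms(1) \<open>x < z\<close> by (auto simp: is_kl_family_def)
  ultimately show ?thesis using le_degree[OF assms(2)] by linarith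
qed

text \<open>Multiplication by the Kazhdan-Lusztig element of \<open>a\<close> preserves
  bar-invariance: bar sends its factor to \<open>qhalf_pow 1\<close> times the inverse operator plus
  one, which is the same operator.\<close>

lemma hecke_bar_step:
  assumes "a \<in> simples" "hecke_bar C = C"
  shows "hecke_bar (hscale (qhalf_pow (- 1)) (mult_Ts a C + C)) = hscale (qhalf_pow (- 1)) (mult_Ts a C + C)"
proof -
  have "qhalf_pow 1 * qhalf_pow (- 2) = qhalf_pow (- 1)" "qhalf_pow (- 1) * hq = qhalf_pow 1"
    by (simp_all add: qhalf_pow_add hq_def)
  then show ?thesis
    using assms
    by (simp add: hecke_bar_hscale hecke_bar_add hecke_bar_mult_Ts mult_Ts_inv_def hscale_add hscale_diff
        hscale_hscale right_diff_distrib hscale_diff_left)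
qed

text \<open>Existence step. The corrected product is a combination of bar-invariant elements, and
  the correction removes precisely the coefficients that exceed the degree bound.\<close>

lemma is_kl_family_kl_rec:
  assumes a: "a \<in> simples" "\<not> down a v"
    and fam: "\<And>z. z \<le> v \<Longrightarrow> is_kl_family z (\<lambda>y. kl_poly y z)"
  shows "is_kl_family (a * v) (kl_rec a v)"
proof -
  define w where "w = a * v"
  define Z where "Z = {z. z < v \<and> down a z \<and> odd (len v - len z)}"
  have w: "len w = Suc (len v)" "down a w" "v \<le> w" "a * w = v"
    using a len_up[OF a] le_simple_mult[OF a] by (simp_all add: w_def)
  have finZ: "finite Z" unfolding Z_def by (rule finite_less)
  have famv: "is_kl_family v (\<lambda>y. kl_poly y v)" using fam by simp
  have famZ: "is_kl_family z (\<lambda>y. kl_poly y z)" if "z \<in> Z" for z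
    using that fam by (simp add: Z_def less_weyl_def)
  have zlen: "len z < len v" "even (Suc (len v) - len z)" if "z \<in> Z" for z
    using that less_imp_len_less[of z v] by (auto simp: Z_def Suc_diff_le)
  have kl0: "kl_poly y z = 0" if "z \<le> v" "\<not> y \<le> z" for y z
    using fam[OF that(1)] that(2) by (simp add: is_kl_family_def)
  have rec: "kl_rec a v y =
    (if down a y then kl_poly (a * y) v + monom 1 1 * kl_poly y v
     else kl_poly y v + monom 1 1 * kl_poly (a * y) v)
    - (\<Sum>z\<in>Z. monom (mu z v) ((Suc (len v) - len z) div 2) * kl_poly y z)" for y
    by (simp only: kl_rec_def Z_def)
  have out: "kl_rec a v y = 0" if "\<not> y \<le> w" for y
  proof -
    have y: "\<not> y \<le> v" using that w(3) by (metis order.trans)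
    have ay: "\<not> a * y \<le> v" using that simple_mult_mono[of a "a * y" v] a by (auto simp: w_def)
    have "kl_poly y z = 0" if "z \<in> Z" for z
    proof (rule kl0)
      show "z \<le> v" using that by (simp add: Z_def less_weyl_def)
      then show "\<not> y \<le> z" using y by (metis order.trans)
    qed
    then show ?thesis using kl0[of v y] kl0[of v "a * y"] y ay
      by (simp add: rec)
  qed
  define X where "X = hscale (qhalf_pow (- 1))
    (mult_Ts a (kl_element v (\<lambda>y. kl_poly y v)) + kl_element v (\<lambda>y. kl_poly y v))"
  define Y where "Y z = hscale (Poly_Mapping.single 0 (mu z v)) (kl_element z (\<lambda>y. kl_poly y z))" for z
  have "kl_element w (kl_rec a v) = X - sum Y Z"
  proof (rule poly_mapping_eqI)
    fix x
    have Y: "Poly_Mapping.lookup (Y z) x = qhalf_pow (- int (len w)) *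
        laurent_of_poly (monom (mu z v) ((Suc (len v) - len z) div 2) * kl_poly x z)" if "z \<in> Z" for z
    proof -
      have "2 * int ((Suc (len v) - len z) div 2) = int (len w) - int (len z)"
        using dvd_mult_div_cancel[OF zlen(2)[OF that]] zlen(1)[OF that] w(1) by linarith
      then have "qhalf_pow (- int (len w)) * Poly_Mapping.single (2 * int ((Suc (len v) - len z) div 2)) (mu z v)
          = Poly_Mapping.single 0 (mu z v) * qhalf_pow (- int (len z))"
        by (simp add: qhalf_pow_def mult_single)
      moreover have "z \<le> v" using that by (simp add: Z_def less_weyl_def)
      ultimately show ?thesis
        by (simp add: Y_def lookup_kl_element kl0 laurent_of_poly_monom_mult mult.assoc[symmetric])
    qed
    have q: "qhalf_pow (- 1) * qhalf_pow (- int (len v)) = qhalf_pow (- int (len w))"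
      using w(1) by (simp add: qhalf_pow_add)
    have m: "laurent_of_poly (monom 1 1 * p) = hq * laurent_of_poly p" for p
      by (simp add: laurent_of_poly_monom_mult hq_def qhalf_pow_def)
    define A B where "A = laurent_of_poly (kl_poly (a * x) v)" and "B = laurent_of_poly (kl_poly x v)"
    let ?c = "qhalf_pow (- int (len v))"
    have "Poly_Mapping.lookup X x = qhalf_pow (- 1) *
       ((if down a x then ?c * A + (hq - 1) * (?c * B) else hq * (?c * A)) + ?c * B)"
      using a(1) by (simp add: X_def lookup_add lookup_mult_Ts lookup_kl_element kl0 A_def B_def)
    also have "... = qhalf_pow (- int (len w)) * (if down a x then A + hq * B else B + hq * A)"
      by (simp add: q[symmetric] algebra_simps)
    finally have "Poly_Mapping.lookup X x = qhalf_pow (- int (len w)) * laurent_of_poly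
       (if down a x then kl_poly (a * x) v + monom 1 1 * kl_poly x v
        else kl_poly x v + monom 1 1 * kl_poly (a * x) v)"
      by (simp add: laurent_of_poly_add m A_def B_def del: One_nat_def)
    moreover have "Poly_Mapping.lookup (kl_element w (kl_rec a v)) x =
        qhalf_pow (- int (len w)) * laurent_of_poly (kl_rec a v x)"
      by (rule lookup_kl_element) (rule out)
    ultimately show "Poly_Mapping.lookup (kl_element w (kl_rec a v)) x = Poly_Mapping.lookup (X - sum Y Z) x"
      by (simp add: lookup_minus lookup_sum Y rec laurent_of_poly_diff laurent_of_poly_sum
          right_diff_distrib sum_distrib_left)
  qed
  moreover have "hecke_bar (X - sum Y Z) = X - sum Y Z"
  proof -
    have "hecke_bar X = X" unfolding X_def
      using famv a(1) by (intro hecke_bar_step) (simp_all add: is_kl_family_def)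
    moreover have "hecke_bar (Y z) = Y z" if "z \<in> Z" for z
      using famZ[OF that] by (simp add: Y_def hecke_bar_hscale laurent_bar_single is_kl_family_def)
    ultimately show ?thesis by (simp add: hecke_bar_diff hecke_bar_sum)
  qed
  ultimately have inv: "hecke_bar (kl_element w (kl_rec a v)) = kl_element w (kl_rec a v)" by simp
  have top: "kl_rec a v w = 1"
  proof -
    have "\<not> w \<le> z" if "z \<le> v" for z
      using le_imp_len_le[of w z] le_imp_len_le[OF that] w(1) by auto
    then have "kl_poly w z = 0" if "z \<le> v" for z using kl0 that by blast
    moreover have "kl_poly v v = 1" using famv by (simp add: is_kl_family_def)
    ultimately show ?thesis
      using w by (simp add: rec Z_def less_weyl_def)
  qed
  \<comment> \<open>The degree bound in coefficient form. Only the term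
    \<open>monom 1 1 * kl_poly y v\<close> with \<open>a\<close> a descent of \<open>y\<close> can
    reach such a degree, and the summand \<open>z = y\<close> cancels it.\<close>
  have deg: "coeff (kl_rec a v y) i = 0" if y: "y < w" and i: "len w - len y \<le> 2 * i" for y i
  proof -
    have leny: "len y \<le> len v" using less_imp_len_less[OF y] w(1) by simp
    have nz: "x = v \<and> j = 0 \<or> x < v \<and> 2 * j + 1 \<le> len v - len x" if "coeff (kl_poly x v) j \<noteq> 0" for x j
      using coeff_kl_poly_nonzero[OF famv that] .
    have i0: "i > 0" using i leny w(1) by auto
    then have cm: "coeff (monom 1 1 * p) i = coeff p (i - 1)" for p :: "int poly"
      by (simp add: coeff_monom_mult)
    have sum0: "coeff (monom (mu z v) ((Suc (len v) - len z) div 2) * kl_poly y z) i = 0"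
      if z: "z \<in> Z" "z \<noteq> y" for z
    proof (rule ccontr)
      let ?j = "(Suc (len v) - len z) div 2"
      assume "coeff (monom (mu z v) ?j * kl_poly y z) i \<noteq> 0"
      then have j: "?j \<le> i" "coeff (kl_poly y z) (i - ?j) \<noteq> 0"
        by (auto simp: coeff_monom_mult split: if_splits)
      from coeff_kl_poly_nonzero[OF famZ[OF z(1)] j(2)] z(2)
      have yz: "y < z" "2 * (i - ?j) + 1 \<le> len z - len y" by auto
      have "2 * ?j = Suc (len v) - len z" using zlen[OF z(1)] by simp
      then show False
        using yz(2) j(1) i w(1) zlen(1)[OF z(1)] less_imp_len_less[OF yz(1)] by linarith
    qed
    show ?thesis
    proof (cases "down a y")
      case False
      then have lay: "len (a * y) = Suc (len y)" using len_up a(1) by blast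
      have 1: "coeff (kl_poly y v) i = 0"
        using nz[of y i] i i0 leny w(1) by fastforce
      have "a * y \<noteq> v" using False a by auto
      then have 2: "coeff (kl_poly (a * y) v) (i - 1) = 0"
        using nz[of "a * y" "i - 1"] i i0 leny w(1) lay by fastforce
      have "y \<notin> Z" using False by (simp add: Z_def)
      then have "(\<Sum>z\<in>Z. coeff (monom (mu z v) ((Suc (len v) - len z) div 2) * kl_poly y z) i) = 0"
        using sum0 by (intro sum.neutral) blast
      then show ?thesis using False 1 2 by (simp add: rec coeff_sum cm del: One_nat_def)
    next
      case True
      then have lay: "len y = Suc (len (a * y))" using len_down a(1) by blast
      have "a * y \<noteq> v" using y a(1) by (auto simp: w_def)
      then have 1: "coeff (kl_poly (a * y) v) i = 0"
        using nz[of "a * y" i] i i0 leny w(1) lay by fastforce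
      have "(\<Sum>z\<in>Z. coeff (monom (mu z v) ((Suc (len v) - len z) div 2) * kl_poly y z) i) =
          (\<Sum>z\<in>Z. if z = y then coeff (kl_poly y v) (i - 1) else 0)"
      proof (rule sum.cong[OF HOL.refl])
        fix z assume z: "z \<in> Z"
        show "coeff (monom (mu z v) ((Suc (len v) - len z) div 2) * kl_poly y z) i =
            (if z = y then coeff (kl_poly y v) (i - 1) else 0)"
        proof (cases "z = y")
          case zy: True
          have kl1: "kl_poly y y = 1" using famZ[OF z] zy by (simp add: is_kl_family_def)
          have j: "2 * ((Suc (len v) - len y) div 2) = Suc (len v) - len y"
            "len y < len v" using zlen[OF z] zy by simp_all
          show ?thesis
          proof (cases "2 * i = Suc (len v) - len y")
            case True
            \<comment> \<open>In this critical degree the coefficient of \<open>kl_poly y v\<close>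
              is \<open>mu y v\<close> by definition.\<close>
            then have "(len v - len y - 1) div 2 = i - 1" using j by linarith
            moreover have "(Suc (len v) - len y) div 2 = i" using True by linarith
            ultimately show ?thesis using z zy kl1 by (simp add: mu_def Z_def coeff_monom_mult)
          next
            case False
            then have "(Suc (len v) - len y) div 2 < i" using i w(1) j by linarith
            moreover have "coeff (kl_poly y v) (i - 1) = 0"
              using nz[of y "i - 1"] False j i w(1) by fastforce
            ultimately show ?thesis using zy kl1 by (simp add: coeff_monom_mult)
          qed
        next
          case False
          then show ?thesis using sum0[OF z] by simp
        qed
      qed
      also have "... = coeff (kl_poly y v) (i - 1)"
      proof (cases "y \<in> Z")
        case True
        then show ?thesis using finZ by simp
      next
        case False
        \<comment> \<open>A nonzero coefficient would lie in the top permitted degree, forcing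
          \<open>y < v\<close> and odd length difference, hence \<open>y \<in> Z\<close>.\<close>
        have "coeff (kl_poly y v) (i - 1) = 0"
        proof (rule ccontr)
          assume "coeff (kl_poly y v) (i - 1) \<noteq> 0"
          from nz[OF this] True a(2) have "y < v" "2 * (i - 1) + 1 \<le> len v - len y" by auto
          with i w(1) i0 have "len v - len y = 2 * (i - 1) + 1" by linarith
          then have "odd (len v - len y)" by simp
          then show False using False True \<open>y < v\<close> by (simp add: Z_def)
        qed
        then show ?thesis using False finZ by simp
      qed
      finally show ?thesis using True 1 by (simp add: rec coeff_sum cm del: One_nat_def)
    qed
  qed
  have "2 * degree (kl_rec a v y) + 1 \<le> len w - len y" if "y < w" for y
  proof (cases "kl_rec a v y = 0")
    case True
    then show ?thesis using less_imp_len_less[OF that] by simp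
  next
    case False
    then have "coeff (kl_rec a v y) (degree (kl_rec a v y)) \<noteq> 0" by simp
    then show ?thesis using deg[OF that] by (metis Suc_eq_plus1 not_less_eq_eq)
  qed
  then show ?thesis
    unfolding is_kl_family_def w_def[symmetric] using inv top out by blast
qed

text \<open>By induction \<open>kl_poly\<close> is already a genuine family at smaller lengths, so
  the recursion gives existence at \<open>w\<close>; uniqueness identifies the result with the
  definite description.\<close>

lemma is_kl_family_kl_poly: "is_kl_family w (\<lambda>y. kl_poly y w)"
proof (induction "len w" arbitrary: w rule: less_induct)
  case less
  have "\<exists>P. is_kl_family w P"
  proof (cases "w = 1")
    case True
    have le1: "y \<le> 1 \<longleftrightarrow> y = 1" for y :: weyl using le_imp_len_le[of y 1] by auto
    have "kl_element 1 (\<lambda>y. if y = 1 then 1 else 0) = hT 1"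
      by (simp add: kl_element_def le1 hscale_one)
    then have "is_kl_family w (\<lambda>y. if y = 1 then 1 else 0)"
      unfolding is_kl_family_def by (simp add: True hecke_bar_hT_one le1 less_weyl_def)
    then show ?thesis by blast
  next
    case False
    then obtain a where a: "a \<in> simples" "down a w" using down_exists by blast
    have "is_kl_family (a * (a * w)) (kl_rec a (a * w))"
    proof (rule is_kl_family_kl_rec)
      fix z assume "z \<le> a * w"
      then show "is_kl_family z (\<lambda>y. kl_poly y z)"
        using le_imp_len_le[of z "a * w"] len_down[OF a] by (intro less) simp
    qed (use a in auto)
    then show ?thesis using a by auto
  qed
  then obtain P where P: "is_kl_family w P" ..
  then have "(\<lambda>y. kl_poly y w) = P" using is_kl_family_imp_kl_poly by auto
  then show ?case using P by simp
qed

lemma kl_poly_recursion: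
  assumes "a \<in> simples" "\<not> down a v" shows "kl_poly y (a * v) = kl_rec a v y"
  using assms by (intro is_kl_family_imp_kl_poly is_kl_family_kl_rec is_kl_family_kl_poly)

section \<open>Symmetries, constant terms and the coefficient \<open>mu\<close> in length difference
  3\<close>

lemma kl_poly_outside: "\<not> y \<le> w \<Longrightarrow> kl_poly y w = 0"
  using is_kl_family_kl_poly[of w] by (simp add: is_kl_family_def)

text \<open>The first part of the recursion is symmetric under exchanging \<open>y\<close> and
  \<open>ay\<close>; the correction terms involve only \<open>z\<close> with \<open>a\<close> as a
  descent, so they are symmetric by induction.\<close>

lemma kl_poly_simple_mult:
  assumes "a \<in> simples" "down a w" shows "kl_poly (a * y) w = kl_poly y w"
  using assms(2)
proof (induction "len w" arbitrary: w rule: less_induct)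
  case less
  define v where "v = a * w"
  have v: "w = a * v" "\<not> down a v" "len v < len w"
    using less.prems assms(1) len_down[OF assms(1) less.prems] by (auto simp: v_def)
  have "kl_poly (a * y) z = kl_poly y z" if "z < v" "down a z" for z
    using less.hyps[OF _ that(2)] less_imp_len_less[OF that(1)] v(3) by simp
  then have "kl_rec a v (a * y) = kl_rec a v y"
    using assms(1) by (simp add: kl_rec_def)
  then show ?case using kl_poly_recursion[OF assms(1) v(2)] v(1) by simp
qed

text \<open>By the preceding symmetry \<open>a\<close> may be taken as a descent of
  \<open>y\<close>. Then every term of the recursion except \<open>kl_poly (a * y) v\<close> is
  divisible by \<open>q\<close>.\<close>

lemma coeff_0_kl_poly: "y \<le> w \<Longrightarrow> coeff (kl_poly y w) 0 = 1"
proof (induction "len w" arbitrary: w y rule: less_induct)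
  case less
  show ?case
  proof (cases "w = 1")
    case True
    then have "y = w" using le_imp_len_le[OF less.prems] by simp
    then show ?thesis using is_kl_family_kl_poly[of w] by (simp add: is_kl_family_def)
  next
    case False
    then obtain a where a: "a \<in> simples" "down a w" using down_exists by blast
    define v where "v = a * w"
    have v: "w = a * v" "\<not> down a v" "len v < len w"
      using a len_down[OF a] by (auto simp: v_def)
    have main: "coeff (kl_poly x w) 0 = 1" if x: "x \<le> w" "down a x" for x
    proof -
      have "a * x \<le> v" using lifting_down a x by (simp add: v_def)
      then have "coeff (kl_poly (a * x) v) 0 = 1" using less.hyps v(3) by blast
      moreover have "coeff (monom (mu z v) ((Suc (len v) - len z) div 2) * kl_poly x z) 0 = 0"
        if "z < v" for z
        using less_imp_len_less[OF that] by (simp add: coeff_monom_mult)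
      ultimately show ?thesis
        unfolding v(1) kl_poly_recursion[OF a(1) v(2)] using x(2)
        by (simp add: kl_rec_def coeff_sum coeff_monom_mult)
    qed
    show ?thesis
    proof (cases "down a y")
      case True
      then show ?thesis using main less.prems by blast
    next
      case False
      then have "coeff (kl_poly (a * y) w) 0 = 1"
        using main[of "a * y"] simple_mult_le_down[OF a(1) less.prems a(2)] a(1) by simp
      then show ?thesis using kl_poly_simple_mult[OF a] by simp
    qed
  qed
qed

lemma mu_eq_1: "z < v \<Longrightarrow> len v = Suc (len z) \<Longrightarrow> mu z v = 1"
  by (simp add: mu_def coeff_0_kl_poly less_weyl_def)

lemma mu_len_3: "u \<le> w \<Longrightarrow> len w = len u + 3 \<Longrightarrow> mu u w = coeff (kl_poly u w) 1"
  by (auto simp: mu_def less_weyl_def)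

text \<open>Otherwise \<open>kl_poly (a * u) w\<close> would have the same nonzero coefficient of
  \<open>q\<close>, but in length difference 2 the degree bound leaves only a constant.\<close>

lemma down_if_mu_nonzero:
  assumes "a \<in> simples" "down a w" "len w = len u + 3" "mu u w \<noteq> 0"
  shows "down a u"
proof (rule ccontr)
  assume "\<not> down a u"
  then have l: "len (a * u) = Suc (len u)" using len_up assms(1) by blast
  have "u \<le> w" using assms(4) by (auto simp: mu_def less_weyl_def split: if_splits)
  then have "coeff (kl_poly (a * u) w) 1 \<noteq> 0"
    using assms kl_poly_simple_mult[of a w u] mu_len_3[of u w] by simp
  from coeff_kl_poly_nonzero[OF is_kl_family_kl_poly this] show False
    using assms(3) l by auto
qed

text \<open>Compare coefficients of \<open>q\<close>. A correction term from \<open>z\<close> of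
  length \<open>len v - 1\<close> contributes the constant term of \<open>kl_poly u z\<close>, which
  tests \<open>u \<le> z\<close>; all others start in degree at least 2.\<close>

lemma mu_recursion:
  assumes a: "a \<in> simples" "\<not> down a v" "down a u" and u: "u \<le> a * v" "len v = len u + 2"
  shows "mu u (a * v) = mu (a * u) v + (if u \<le> v then 1 else 0)
    - int (card {z. u \<le> z \<and> z < v \<and> down a z \<and> len v = Suc (len z)})"
proof -
  define Z where "Z = {z. z < v \<and> down a z \<and> odd (len v - len z)}"
  define Z1 where "Z1 = {z. u \<le> z \<and> z < v \<and> down a z \<and> len v = Suc (len z)}"
  have lau: "len u = Suc (len (a * u))" using len_down a by blast
  have "a * u \<le> v" using lifting_down[of a u "a * v"] a u by simp
  then have mu': "mu (a * u) v = coeff (kl_poly (a * u) v) 1"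
    using mu_len_3 lau u(2) by simp
  have "coeff (kl_poly u v) 0 = (if u \<le> v then 1 else 0)"
    by (simp add: coeff_0_kl_poly kl_poly_outside)
  moreover have "(\<Sum>z\<in>Z. coeff (monom (mu z v) ((Suc (len v) - len z) div 2) * kl_poly u z) 1) =
      (\<Sum>z\<in>Z. if z \<in> Z1 then 1 else 0)"
  proof (rule sum.cong[OF HOL.refl])
    fix z assume z: "z \<in> Z"
    then have lz: "len z < len v" using less_imp_len_less by (auto simp: Z_def)
    show "coeff (monom (mu z v) ((Suc (len v) - len z) div 2) * kl_poly u z) 1 = (if z \<in> Z1 then 1 else 0)"
    proof (cases "len v = Suc (len z)")
      case True
      then show ?thesis using z mu_eq_1[of z v]
        by (auto simp: Z_def Z1_def coeff_monom_mult coeff_0_kl_poly kl_poly_outside)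
    next
      case False
      moreover have "odd (len v - len z)" using z by (simp add: Z_def)
      ultimately have "len z + 3 \<le> len v" using lz by presburger
      then have "\<not> (Suc (len v) - len z) div 2 \<le> 1" by linarith
      then show ?thesis using False by (simp add: Z1_def coeff_monom_mult)
    qed
  qed
  moreover have "(\<Sum>z\<in>Z. if z \<in> Z1 then 1 else (0::int)) = int (card Z1)"
  proof -
    have "Z1 \<subseteq> Z" by (auto simp: Z1_def Z_def)
    then show ?thesis
      using finite_less[of v "\<lambda>z. down a z \<and> odd (len v - len z)"]
      unfolding Z_def[symmetric] by (simp add: sum.If_cases Int_absorb1)
  qed
  moreover have "mu u (a * v) = coeff (kl_rec a v u) 1"
    using mu_len_3[OF u(1)] len_up[of a v] a u(2) kl_poly_recursion[of a v u] by simp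
  ultimately show ?thesis
    using a(3) mu' unfolding kl_rec_def Z_def[symmetric] Z1_def[symmetric]
    by (simp add: coeff_sum coeff_monom_mult del: One_nat_def)
qed

text \<open>The anti-involution \<open>flip\<close> commutes with bar, so it carries the
  Kazhdan-Lusztig element of \<open>w\<close> to a valid one for \<open>winv w\<close>; uniqueness
  concludes.\<close>

lemma kl_poly_winv: "kl_poly (winv y) (winv w) = kl_poly y w"
proof -
  have out: "kl_poly (winv y) w = 0" if "\<not> y \<le> winv w" for y
    using that kl_poly_outside winv_le_winv_iff[of y "winv w"] by simp
  have "kl_element (winv w) (\<lambda>y. kl_poly (winv y) w) = flip (kl_element w (\<lambda>y. kl_poly y w))"
    by (rule poly_mapping_eqI) (simp add: lookup_kl_element out kl_poly_outside)
  moreover have "y < winv w \<longleftrightarrow> winv y < w" for y using winv_less_winv_iff[of y "winv w"] by simp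
  moreover have "2 * degree (kl_poly (winv y) w) + 1 \<le> len w - len y" if "winv y < w" for y
    using is_kl_family_kl_poly[of w] that by (auto simp: is_kl_family_def dest: spec[of _ "winv y"])
  ultimately have "is_kl_family (winv w) (\<lambda>y. kl_poly (winv y) w)"
    using is_kl_family_kl_poly[of w] out by (simp add: is_kl_family_def hecke_bar_flip)
  from is_kl_family_imp_kl_poly[OF this, of "winv y"] show ?thesis by simp
qed

lemma mu_winv: "mu (winv u) (winv w) = mu u w"
  by (simp add: mu_def kl_poly_winv)

subsection \<open>Elements with a unique reduced expression\<close>

definition sole_reduced :: "weyl list \<Rightarrow> weyl \<Rightarrow> bool" where
  "sole_reduced ss w \<longleftrightarrow> reduced_expression ss w \<and> (\<forall>ts. reduced_expression ts w \<longrightarrow> ts = ss)"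

text \<open>Unlike \<open>c1\<close> this admits the identity, with its empty expression, so that
  \<open>c0\<close> is exactly the complement.\<close>

definition rigid :: "weyl \<Rightarrow> bool" where
  "rigid w \<longleftrightarrow> (\<exists>ss. sole_reduced ss w)"

lemma rigid_iff_ex1: "rigid w \<longleftrightarrow> (\<exists>!ss. reduced_expression ss w)"
  unfolding rigid_def sole_reduced_def by auto

lemma c0_iff: "u \<in> c0 \<longleftrightarrow> \<not> rigid u"
proof -
  have "sole_reduced [] 1"
    by (auto simp: sole_reduced_def reduced_expression_def expression_def)
  then have "rigid 1" by (auto simp: rigid_def)
  then show ?thesis by (auto simp: c0_def c1_def rigid_iff_ex1[symmetric])
qed

lemma sole_reduced_rev: "sole_reduced ss w \<Longrightarrow> sole_reduced (rev ss) (winv w)"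
  unfolding sole_reduced_def using reduced_expression_rev by (metis rev_rev_ident winv_winv)

lemma rigid_winv: "rigid (winv w) \<longleftrightarrow> rigid w"
  unfolding rigid_def using sole_reduced_rev by (metis winv_winv)

lemma sole_reduced_ConsD:
  assumes "sole_reduced (a # ss) w"
  shows "a \<in> simples" "down a w" "sole_reduced ss (a * w)" "len w = Suc (length ss)"
    "\<And>b. b \<in> simples \<Longrightarrow> down b w \<Longrightarrow> b = a"
proof -
  have red: "reduced_expression (a # ss) w" and sole: "\<And>ts. reduced_expression ts w \<Longrightarrow> ts = a # ss"
    using assms by (auto simp: sole_reduced_def)
  show a: "a \<in> simples" "down a w" and "len w = Suc (length ss)"
    using red by (simp add: reduced_expression_Cons, simp add: reduced_expression_Cons,
        simp add: reduced_expression_def)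
  have "ts = ss" if "reduced_expression ts (a * w)" for ts
    using sole[of "a # ts"] that a by (simp add: reduced_expression_Cons)
  then show "sole_reduced ss (a * w)"
    using red by (auto simp: sole_reduced_def reduced_expression_Cons)
  fix b assume b: "b \<in> simples" "down b w"
  obtain ts where "reduced_expression ts (b * w)" using reduced_expression_exists by blast
  then have "reduced_expression (b # ts) w" using b by (simp add: reduced_expression_Cons)
  then show "b = a" using sole by blast
qed

lemma rigid_down_unique:
  assumes "rigid w" "a \<in> simples" "b \<in> simples" "down a w" "down b w"
  shows "a = b"
proof -
  obtain ss where ss: "sole_reduced ss w" using assms(1) by (auto simp: rigid_def)
  then obtain x ts where "ss = x # ts"
    using assms(4) by (cases ss) (auto simp: sole_reduced_def reduced_expression_def expression_def)
  then show ?thesis using sole_reduced_ConsD(5) ss assms by blast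
qed

lemma rigid_simple_mult:
  assumes "a \<in> simples" "down a u" "\<And>b. b \<in> simples \<Longrightarrow> down b u \<Longrightarrow> b = a" "rigid (a * u)"
  shows "rigid u"
proof -
  obtain ss where ss: "sole_reduced ss (a * u)" using assms(4) by (auto simp: rigid_def)
  have "ts = a # ss" if "reduced_expression ts u" for ts
  proof (cases ts)
    case Nil
    then show ?thesis
      using that assms(2) by (auto simp: reduced_expression_def expression_def)
  next
    case (Cons b ts')
    then show ?thesis
      using that assms(3)[of b] ss by (auto simp: reduced_expression_Cons sole_reduced_def)
  qed
  moreover have "reduced_expression (a # ss) u"
    using ss assms(1,2) by (simp add: sole_reduced_def reduced_expression_Cons)
  ultimately show ?thesis unfolding rigid_def sole_reduced_def by blast
qed

fun cyclic_word :: "'a \<Rightarrow> 'a \<Rightarrow> 'a \<Rightarrow> nat \<Rightarrow> 'a list" where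
  "cyclic_word a b c 0 = []"
| "cyclic_word a b c (Suc n) = a # cyclic_word b c a n"

lemma length_cyclic_word [simp]: "length (cyclic_word a b c n) = n"
  by (induction a b c n rule: cyclic_word.induct) auto

text \<open>A third letter equal to the second would contradict reducedness, and one equal to the
  first would allow a braid move to another expression. Hence the letters rotate.\<close>

lemma sole_reduced_cyclic:
  assumes "sole_reduced (a # b # ss) w" "simples = {a, b, c}"
  shows "a # b # ss = cyclic_word a b c (Suc (Suc (length ss)))"
  using assms
proof (induction ss arbitrary: a b c w)
  case (Cons x ss)
  note S = sole_reduced_ConsD[OF Cons.prems(1)]
  have x: "x \<in> simples"
    using sole_reduced_ConsD[OF S(3)] sole_reduced_ConsD(1) by blast
  have s: "a \<in> simples" "b \<in> simples" and ne: "a \<noteq> b"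
    using Cons.prems(2) simples_distinct by auto
  have "x \<noteq> b"
    using sole_reduced_ConsD(2)[OF S(3)] sole_reduced_ConsD(2)[OF sole_reduced_ConsD(3)[OF S(3)]] s by auto
  moreover have "x \<noteq> a"
  proof
    assume "x = a"
    then have "reduced_expression (a # b # a # ss) w" using Cons.prems(1) by (simp add: sole_reduced_def)
    then have "reduced_expression (b # a # b # ss) w"
      using simple_braid_left[OF s ne, of "prod_list ss"] s
      by (simp add: reduced_expression_def expression_def)
    then show False using Cons.prems(1) ne by (auto simp: sole_reduced_def)
  qed
  ultimately have "x = c" using x Cons.prems(2) by auto
  moreover have "simples = {b, c, a}" using Cons.prems(2) by auto
  ultimately show ?case using Cons.IH[of b x "a * w" a] S(3) by simp
qed simp

subsection \<open>Vanishing of \<open>\<mu>\<close>\<close>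

text \<open>All labellings of the generators are treated together, since the induction removes
  letters from the front of the cyclic word and thereby rotates it.\<close>

lemma mu_nonzero_descents:
  assumes "simples = {a, b, c}" "sole_reduced (cyclic_word a b c (len u + 3)) w"
    "\<not> rigid u" "mu u w \<noteq> 0"
  shows "down a u \<and> \<not> down b u \<and> down c u"
  using assms
proof (induction "len u" arbitrary: a b c u w rule: less_induct)
  case less
  define m where "m = len u"
  have s: "a \<in> simples" "b \<in> simples" "c \<in> simples" using less.prems(1) by auto
  have ne: "a \<noteq> b" "b \<noteq> c" "a \<noteq> c" using simples_distinct[OF less.prems(1)] by auto
  have perm: "simples = {b, c, a}" "simples = {c, a, b}" "simples = {b, a, c}"
    using less.prems(1) by auto
  have uw: "u \<le> w" using less.prems(4) by (auto simp: mu_def less_weyl_def split: if_splits)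
  define v where "v = a * w"
  define w2 where "w2 = b * v"
  define w3 where "w3 = c * w2"
  have "sole_reduced (a # cyclic_word b c a (m + 2)) w"
    using less.prems(2) by (simp add: m_def numeral_3_eq_3)
  note W = sole_reduced_ConsD[OF this, folded v_def]
  have "sole_reduced (b # cyclic_word c a b (m + 1)) v"
    using W(3) by (simp add: numeral_2_eq_2)
  note V = sole_reduced_ConsD[OF this, folded w2_def]
  have "sole_reduced (c # cyclic_word a b c m) w2" using V(3) by simp
  note W2 = sole_reduced_ConsD[OF this, folded w3_def]
  have len3: "len w3 = m" using W2(3) by (simp add: sole_reduced_def reduced_expression_def)
  have wv: "w = a * v" "v = b * w2" "w2 = c * w3" using s by (simp_all add: v_def w2_def w3_def)
  have lens: "len w = m + 3" "len v = m + 2" "len w2 = m + 1"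
    using W(4) V(4) W2(4) by simp_all
  have nd: "\<not> down a v" "\<not> down b w2" "\<not> down a w2"
    using V(5) W2(5) s ne by blast+
  have au: "down a u" using down_if_mu_nonzero[OF s(1) W(2) _ less.prems(4)] lens(1) by (simp add: m_def)
  have lau: "len u = Suc (len (a * u))" using len_down[OF s(1) au] .
  define Z where "Z = {z. u \<le> z \<and> z < v \<and> down a z \<and> len v = Suc (len z)}"
  have mu_w: "mu u w = mu (a * u) v + (if u \<le> v then 1 else 0) - int (card Z)"
    using mu_recursion[OF s(1) nd(1) au] uw lens by (simp add: wv(1) Z_def m_def)
  \<comment> \<open>Thus both correction terms of the recursion disappear unless
    \<open>u \<le> v\<close>.\<close>
  have Z_empty: "Z = {}" if "\<not> u \<le> v"
    using that order.trans unfolding Z_def less_weyl_def by blast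
  have bu: "\<not> down b u"
  proof
    assume bu: "down b u"
    define u1 where "u1 = a * u"
    define u2 where "u2 = b * u1"
    have d: "down b u1" "down a u2"
      using down_dihedral[OF s(1,2) ne(1) au bu] down_dihedral2[OF s(1,2) ne(1) au bu]
      by (simp_all add: u1_def u2_def)
    have l: "len u = Suc (len u1)" "len u1 = Suc (len u2)" "len u2 = Suc (len (a * u2))"
      using lau len_down[OF s(2) d(1)] len_down[OF s(1) d(2)] by (simp_all add: u1_def u2_def)
    define k where "k = len (a * u2)"
    \<comment> \<open>Two descents force length at least 3, so the word has at least six letters and
      five of them can be removed.\<close>
    have m: "m = Suc (Suc (Suc k))" using l by (simp add: m_def k_def)
    define w4 where "w4 = a * w3"
    define w5 where "w5 = b * w4"
    have "sole_reduced (a # cyclic_word b c a (Suc (Suc k))) w3" using W2(3) by (simp add: m)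
    note W3 = sole_reduced_ConsD[OF this, folded w4_def]
    have "sole_reduced (b # cyclic_word c a b (Suc k)) w4" using W3(3) by simp
    note W4 = sole_reduced_ConsD[OF this, folded w5_def]
    have "sole_reduced (c # cyclic_word a b c k) w5" using W4(3) by simp
    note W5 = sole_reduced_ConsD[OF this]
    have b3: "\<not> down b w3" using W3(5) s ne by blast
    have cu1: "\<not> down c u1" unfolding u1_def by (rule not_down_third[OF less.prems(1) au bu])
    have cbu: "\<not> down c (b * u)" by (rule not_down_third[OF perm(3) bu au])
    have "mu u1 v = 0"
    proof (rule ccontr)
      assume nz: "mu u1 v \<noteq> 0"
      then have u1v: "u1 \<le> v" by (auto simp: mu_def less_weyl_def split: if_splits)
      \<comment> \<open>Lifting past \<open>c\<close> and then \<open>a\<close> would give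
        \<open>u1 = w4\<close> by length, hence \<open>u2 = w5\<close>. But \<open>a\<close> is a
        descent of \<open>u2\<close>, while \<open>w5\<close> has only the descent
        \<open>c\<close>.\<close>
      have not_le: "\<not> u1 \<le> w2"
      proof
        assume "u1 \<le> w2"
        then have "u1 \<le> w3" using lifting[OF s(3) _ W2(2) cu1] by (simp add: w3_def)
        moreover have "\<not> down a u1" using s au by (simp add: u1_def)
        ultimately have "u1 \<le> w4" using lifting[OF s(1) _ W3(2)] by (simp add: w4_def)
        moreover have "len w4 = len u1" using W4(4) l m by (simp add: k_def)
        ultimately have "u1 = w4" using le_len_eq by simp
        then have "down a w5" using d(2) by (simp add: u2_def w5_def)
        then show False using W5(5) s ne by blast
      qed
      have "mu u1 (b * w2) = mu (b * u1) w2 + (if u1 \<le> w2 then 1 else 0)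
        - int (card {z. u1 \<le> z \<and> z < w2 \<and> down b z \<and> len w2 = Suc (len z)})"
        using u1v l lens by (intro mu_recursion s nd d) (simp_all add: wv(2)[symmetric] m_def)
      moreover have "{z. u1 \<le> z \<and> z < w2 \<and> down b z \<and> len w2 = Suc (len z)} = {}"
        using not_le order.trans unfolding less_weyl_def by blast
      \<comment> \<open>Now \<open>u2\<close> has the descents \<open>a\<close> and
        \<open>c\<close>, so it is not rigid. The induction hypothesis for \<open>w2\<close>, whose
        word begins with \<open>c\<close> and \<open>a\<close>, excludes the descent
        \<open>a\<close>.\<close>
      ultimately have nz2: "mu u2 w2 \<noteq> 0" using nz not_le by (simp add: wv(2)[symmetric] u2_def)
      moreover have len2: "len w2 = len u2 + 3" using lens l by (simp add: m_def)
      ultimately have "down c u2" using down_if_mu_nonzero[OF s(3) W2(2)] by blast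
      then have "\<not> rigid u2" using rigid_down_unique d(2) s ne by blast
      moreover have "len u2 + 3 = m + 1" using lens(3) len2 by simp
      then have "sole_reduced (cyclic_word c a b (len u2 + 3)) w2"
        using V(3) by (simp only:)
      ultimately have "\<not> down a u2"
        using less.hyps[of u2 c a b w2] perm(2) nz2 l by simp
      then show False using d(2) by simp
    qed
    moreover have "int (card Z) = (if u \<le> v then 1 else 0)"
    proof (cases "u \<le> v")
      case True
      \<comment> \<open>Without the descent \<open>b\<close>, lifting would give
        \<open>z = w2\<close>, which lacks the descent \<open>a\<close>. With both descents,
        \<open>c\<close> is not a descent of \<open>bz\<close>, so \<open>bz\<close> lifts down to
        \<open>w3\<close>.\<close>
      have "z = b * w3" if z: "z \<in> Z" for z
      proof -
        have z': "z \<le> v" "down a z" "len z = m + 1"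
          using z lens by (auto simp: Z_def less_weyl_def)
        have bz: "down b z"
        proof (rule ccontr)
          assume "\<not> down b z"
          then have "z \<le> w2" using lifting[OF s(2) z'(1) V(2)] by (simp add: w2_def)
          then have "z = w2" using le_len_eq z'(3) lens by simp
          then show False using z'(2) nd(3) by simp
        qed
        have "b * z \<le> w2" using lifting_down[OF s(2) z'(1) V(2) bz] by (simp add: w2_def)
        moreover have "\<not> down c (b * z)" by (rule not_down_third[OF perm(3) bz z'(2)])
        ultimately have "b * z \<le> w3" using lifting[OF s(3) _ W2(2)] by (simp add: w3_def)
        moreover have "len (b * z) = m" using len_down[OF s(2) bz] z'(3) by simp
        ultimately have "b * z = w3" using le_len_eq len3 by simp
        then show ?thesis using s(2) by auto
      qed
      moreover have "b * w3 \<in> Z"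
      proof -
        have "b * u \<le> w2" using lifting_down[OF s(2) True V(2) bu] by (simp add: w2_def)
        then have "b * u \<le> w3" using lifting[OF s(3) _ W2(2) cbu] by (simp add: w3_def)
        then have "u \<le> b * w3" using simple_mult_mono[OF s(2) _ b3] s(2) by fastforce
        moreover have "w3 \<le> w2" using simple_mult_le[OF s(3) W2(2)] by (simp add: w3_def)
        then have "b * w3 \<le> v" using simple_mult_mono[OF s(2) _ nd(2)] by (simp add: wv(2))
        moreover have lz: "len (b * w3) = m + 1" using len_up[OF s(2) b3] len3 by simp
        moreover have "down a (b * w3)"
        proof -
          \<comment> \<open>The word of \<open>w3\<close> begins with \<open>a\<close> and
            \<open>b\<close>, so a braid move on \<open>aba\<close> makes two letters
            \<open>b\<close> cancel.\<close>
          have "a * (b * w3) = b * (a * w5)"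
            using simple_braid_left[OF s(1,2) ne(1), of w4] s by (simp add: w4_def w5_def)
          moreover have "len (b * (a * w5)) \<le> Suc (Suc (len w5))"
            using len_simple_mult_le[OF s(2), of "a * w5"] len_simple_mult_le[OF s(1), of w5] by simp
          ultimately show ?thesis using W5(4) lz m by (simp add: down_def)
        qed
        ultimately show ?thesis using lens by (auto simp: Z_def less_weyl_def)
      qed
      ultimately have "Z = {b * w3}" by blast
      then show ?thesis using True by simp
    next
      case False
      then show ?thesis using Z_empty by simp
    qed
    ultimately show False using mu_w less.prems(4) by (simp add: u1_def)
  qed
  moreover have "down c u"
  proof (rule ccontr)
    assume cu: "\<not> down c u"
    have only_a: "x = a" if "x \<in> simples" "down x u" for x
      using that bu cu less.prems(1) by auto
    \<comment> \<open>Lifting past \<open>b\<close> and \<open>c\<close> would identify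
      \<open>u\<close> with \<open>w3\<close>, which is rigid.\<close>
    have "\<not> u \<le> v"
    proof
      assume "u \<le> v"
      then have "u \<le> w2" using lifting[OF s(2) _ V(2) bu] by (simp add: w2_def)
      then have "u \<le> w3" using lifting[OF s(3) _ W2(2) cu] by (simp add: w3_def)
      then have "u = w3" using le_len_eq len3 by (simp add: m_def)
      then show False using less.prems(3) W2(3) by (auto simp: rigid_def)
    qed
    then have "mu (a * u) v \<noteq> 0" using mu_w Z_empty less.prems(4) by simp
    moreover have "\<not> rigid (a * u)"
      using rigid_simple_mult[OF s(1) au only_a] less.prems(3) by blast
    moreover have "sole_reduced (cyclic_word b c a (len (a * u) + 3)) v"
      using W(3) lau by (simp add: m_def numeral_3_eq_3)
    \<comment> \<open>In the word of \<open>v\<close> the letter \<open>a\<close> comes third, so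
      the induction hypothesis makes it a descent of \<open>au\<close>, although \<open>a\<close>
      was just removed.\<close>
    ultimately have "down a (a * u)"
      using less.hyps[of "a * u" b c a v] perm(1) lau by simp
    then show False using s au by simp
  qed
  ultimately show ?case using au by blast
qed

lemma mu_nonzero_left_descents:
  assumes "sole_reduced (a # b # ss) w" "len w = len u + 3" "\<not> rigid u" "mu u w \<noteq> 0"
  shows "card (left_descents u) = 2 \<and> a \<in> left_descents u \<and> b \<notin> left_descents u"
proof -
  note S = sole_reduced_ConsD[OF assms(1)]
  note S' = sole_reduced_ConsD[OF S(3)]
  have ne: "a \<noteq> b" using S(1,2) S'(2) by auto
  have "card (simples - {a, b}) = 1"
    using S(1) S'(1) ne card_simples by (subst card_Diff_subset) auto
  then obtain c where "simples - {a, b} = {c}" by (rule card_1_singletonE)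
  then have abc: "simples = {a, b, c}" using S(1) S'(1) by auto
  have "Suc (Suc (length ss)) = len u + 3" using S(4) assms(2) by simp
  then have "a # b # ss = cyclic_word a b c (len u + 3)"
    using sole_reduced_cyclic[OF assms(1) abc] by metis
  then have d: "down a u \<and> \<not> down b u \<and> down c u"
    using mu_nonzero_descents[OF abc _ assms(3,4)] assms(1) by simp
  then have "left_descents u = {a, c}"
    using abc by (auto simp: left_descents_iff)
  then show ?thesis using simples_distinct[OF abc] by auto
qed

theorem theorem5p7:
  fixes w u :: weyl and s :: "nat \<Rightarrow> weyl" and n :: nat
  assumes "w \<in> c1"
    and "reduced_expression (map s [1..<n + 1]) w"
    and "n \<ge> 3"
    and "{s 1, s 2, s 3} = simples"
    and "u \<in> c0_below 3 w"
    and "mu u w \<noteq> 0"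
  shows "card (left_descents u) = 2 \<and> card (right_descents u) = 2 \<and>
    s 1 \<in> left_descents u \<and> s n \<in> right_descents u \<and>
    s 2 \<notin> left_descents u \<and> s (n - 1) \<notin> right_descents u"
proof -
  have sole: "sole_reduced (map s [1..<n + 1]) w"
    using assms(1,2) by (auto simp: c1_def sole_reduced_def)
  have u: "\<not> rigid u" "len w = len u + 3"
    using assms(5) by (auto simp: c0_below_def c0_iff)
  define k where "k = n - 2"
  have k: "n = Suc (Suc k)" using assms(3) by (simp add: k_def)
  have "map s [1..<n + 1] = s 1 # s 2 # map s [3..<n + 1]"
    using assms(3) by (simp add: upt_conv_Cons numeral_2_eq_2 numeral_3_eq_3)
  then have left: "card (left_descents u) = 2 \<and> s 1 \<in> left_descents u \<and> s 2 \<notin> left_descents u"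
    using mu_nonzero_left_descents[of "s 1" "s 2" _ w u] sole u assms(6) by simp
  \<comment> \<open>The reversed word is the sole reduced expression of \<open>winv w\<close>, so
    the left-hand statement for inverses gives the right-hand one.\<close>
  have "rev (map s [1..<n + 1]) = s n # s (n - 1) # rev (map s [1..<n - 1])"
    by (simp add: k)
  then have "sole_reduced (s n # s (n - 1) # rev (map s [1..<n - 1])) (winv w)"
    using sole_reduced_rev[OF sole] by simp
  then have "card (left_descents (winv u)) = 2 \<and> s n \<in> left_descents (winv u) \<and>
      s (n - 1) \<notin> left_descents (winv u)"
    using mu_nonzero_left_descents[of "s n" "s (n - 1)" _ "winv w" "winv u"] u assms(6)
    by (simp add: rigid_winv mu_winv)
  moreover have "left_descents (winv u) = right_descents u" by (auto simp: right_descents_iff)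
  ultimately show ?thesis using left by simp
qed

end
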